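(* The equality $\sharp([\Gamma],\phi)=g(Y)$ does not hold for all classes $[\Gamma]$ and all meromorphic functions $\phi$. That is, there exist a compact Riemann surface $Y$ of genus $g(Y)$, a class $[\Gamma]$ of ribbon graphs spanning $Y$, and a nonconstant meromorphic function $\phi:Y\to\mathbb{CP}^1$ such that $\sharp([\Gamma],\phi)\ne g(Y)$.
   Context: Compact Riemann surfaces are connected. All multigraphs are finite, may have loops and multiple edges, and have no vertices of valence $1$ or $2$. A ribbon graph $\Gamma\subset Y$ is a multigraph embedded in $Y$, with the counterclockwise cyclic order of half-edges at each vertex. It spans $Y$ if $Y\setminus\Gamma$ is a finite disjoint union of open disks. The class $[\Gamma]$ is the orbit of $\Gamma$ under the group $\mathrm{Homeo}_0(Y)$ of all homeomorphisms of $Y$ homotopic to the identity. Given a nonconstant meromorphic $\phi:Y\to\mathbb{CP}^1$, a representative $\widetilde\Gamma\in[\Gamma]$ is generic if: (i) $\phi(\widetilde\Gamma)$ contains no critical values of $\phi$; (ii) the restriction of $\phi$ to each open edge of $\widetilde\Gamma$ is an immersion and all singularities of the image $\phi(\widetilde\Gamma)$ are transverse double points coming from two points lying in open edges. For generic $\widetilde\Gamma$, $\sharp(\widetilde\Gamma,\phi)$ denotes the number of transverse self-intersections (double points) of $\phi(\widetilde\Gamma)$, and $$\sharp([\Gamma],\phi)=\min\{\sharp(\widetilde\Gamma,\phi)\mid \widetilde\Gamma\in[\Gamma]\text{ generic}\}.$$ *)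

theory Defs
  imports "HOL-Complex_Analysis.Complex_Analysis" "HOL-Homology.Homology"
    "HOL-Algebra.Free_Abelian_Groups"
begin

section \<open>Riemann surfaces\<close>

text \<open>
  A surface is a topology together with an atlas of complex charts; a chart is a pair of its
  domain and its coordinate function. The atlas need not be maximal. Points are taken from a
  type; a compact Riemann surface has continuum many points, so up to isomorphism every one lives
  on any given type of at least that cardinality, such as \<open>cp1 \<times> cp1\<close> for the type
  \<open>cp1\<close> introduced below.
\<close>

record 'a rsurface =
  surf_top :: "'a topology"
  surf_charts :: "('a set \<times> ('a \<Rightarrow> complex)) set"

definition complex_chart :: "'a topology \<Rightarrow> 'a set \<Rightarrow> ('a \<Rightarrow> complex) \<Rightarrow> bool" where
  "complex_chart X U f \<longleftrightarrow>
     openin X U \<and> open (f ` U) \<and>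
     homeomorphic_map (subtopology X U) (top_of_set (f ` U)) f"

definition compact_riemann_surface :: "'a rsurface \<Rightarrow> bool" where
  "compact_riemann_surface Y \<longleftrightarrow>
     topspace (surf_top Y) \<noteq> {} \<and>
     compact_space (surf_top Y) \<and> Hausdorff_space (surf_top Y) \<and> connected_space (surf_top Y) \<and>
     (\<forall>(U, f) \<in> surf_charts Y. complex_chart (surf_top Y) U f) \<and>
     (\<Union>(U, f) \<in> surf_charts Y. U) = topspace (surf_top Y) \<and>
     (\<forall>(U, f) \<in> surf_charts Y. \<forall>(V, g) \<in> surf_charts Y.
        (g \<circ> inv_into U f) holomorphic_on f ` (U \<inter> V))"

text \<open>
  The genus: the first integral homology group of a compact Riemann surface of genus \<open>g\<close>
  is free of rank \<open>2 * g\<close>.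
\<close>

definition genus :: "'a rsurface \<Rightarrow> nat" where
  "genus Y = (THE g. homology_group 1 (surf_top Y) \<cong> free_Abelian_group {..<2 * g :: nat})"

definition holomorphic_map :: "'a rsurface \<Rightarrow> 'b rsurface \<Rightarrow> ('a \<Rightarrow> 'b) \<Rightarrow> bool" where
  "holomorphic_map S T F \<longleftrightarrow>
     continuous_map (surf_top S) (surf_top T) F \<and>
     (\<forall>(U, f) \<in> surf_charts S. \<forall>(V, g) \<in> surf_charts T.
        (g \<circ> F \<circ> inv_into U f) holomorphic_on f ` (U \<inter> F -` V))"

definition critical_points :: "'a rsurface \<Rightarrow> 'b rsurface \<Rightarrow> ('a \<Rightarrow> 'b) \<Rightarrow> 'a set" where
  "critical_points S T F =
     {p \<in> topspace (surf_top S). \<exists>(U, f) \<in> surf_charts S. \<exists>(V, g) \<in> surf_charts T.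
        p \<in> U \<and> F p \<in> V \<and> deriv (g \<circ> F \<circ> inv_into U f) (f p) = 0}"

text \<open>The projective line as the Riemann sphere; \<open>None\<close> is the point at infinity.\<close>

type_synonym cp1 = "complex option"

definition CP1 :: "cp1 rsurface" where
  "CP1 = \<lparr>surf_top = Alexandroff_compactification euclidean,
          surf_charts = {(range Some, the),
                         (- {Some 0}, \<lambda>p. case p of None \<Rightarrow> 0 | Some z \<Rightarrow> 1 / z)}\<rparr>"

definition nonconstant_meromorphic :: "'a rsurface \<Rightarrow> ('a \<Rightarrow> cp1) \<Rightarrow> bool" where
  "nonconstant_meromorphic Y \<phi> \<longleftrightarrow>
     holomorphic_map Y CP1 \<phi> \<and> \<not> (\<exists>c. \<forall>p \<in> topspace (surf_top Y). \<phi> p = c)"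


section \<open>Embedded multigraphs\<close>

text \<open>
  An embedded multigraph is given by its vertices (points of the surface) and its open edges
  (subsets of the surface). The cyclic order of the half-edges at the vertices is determined by
  the embedding and the orientation of the surface, so it is not recorded.
\<close>

record 'a egraph =
  verts :: "'a set"
  edges :: "'a set set"

definition graph_support :: "'a egraph \<Rightarrow> 'a set" where
  "graph_support \<Gamma> = verts \<Gamma> \<union> \<Union> (edges \<Gamma>)"

definition edge_param :: "'a topology \<Rightarrow> 'a set \<Rightarrow> 'a set \<Rightarrow> (real \<Rightarrow> 'a) \<Rightarrow> bool" where
  "edge_param X V e \<gamma> \<longleftrightarrow>
     pathin X \<gamma> \<and> \<gamma> 0 \<in> V \<and> \<gamma> 1 \<in> V \<and>
     inj_on \<gamma> {0<..<1} \<and> \<gamma> ` {0<..<1} = e \<and> e \<inter> V = {}"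

definition edge_ends :: "'a topology \<Rightarrow> 'a set \<Rightarrow> 'a set" where
  "edge_ends X e = X closure_of e - e"

text \<open>The number of half-edges at \<open>v\<close>; the second summand counts loops a second time.\<close>

definition valence :: "'a topology \<Rightarrow> 'a egraph \<Rightarrow> 'a \<Rightarrow> nat" where
  "valence X \<Gamma> v =
     card {e \<in> edges \<Gamma>. v \<in> edge_ends X e} + card {e \<in> edges \<Gamma>. edge_ends X e = {v}}"

definition ribbon_graph :: "'a topology \<Rightarrow> 'a egraph \<Rightarrow> bool" where
  "ribbon_graph X \<Gamma> \<longleftrightarrow>
     finite (verts \<Gamma>) \<and> verts \<Gamma> \<subseteq> topspace X \<and>
     finite (edges \<Gamma>) \<and> pairwise disjnt (edges \<Gamma>) \<and>
     (\<forall>e \<in> edges \<Gamma>. \<exists>\<gamma>. edge_param X (verts \<Gamma>) e \<gamma>) \<and>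
     (\<forall>v \<in> verts \<Gamma>. valence X \<Gamma> v \<noteq> 1 \<and> valence X \<Gamma> v \<noteq> 2)"

definition spans :: "'a topology \<Rightarrow> 'a egraph \<Rightarrow> bool" where
  "spans X \<Gamma> \<longleftrightarrow>
     (let W = subtopology X (topspace X - graph_support \<Gamma>)
      in finite (connected_components_of W) \<and>
         (\<forall>C \<in> connected_components_of W.
            subtopology X C homeomorphic_space top_of_set (ball (0 :: complex) 1)))"

definition Homeo0 :: "'a topology \<Rightarrow> ('a \<Rightarrow> 'a) set" where
  "Homeo0 X = {h. homeomorphic_map X X h \<and> homotopic_with (\<lambda>_. True) X X h id}"

definition graph_image :: "('a \<Rightarrow> 'a) \<Rightarrow> 'a egraph \<Rightarrow> 'a egraph" where
  "graph_image h \<Gamma> = \<lparr>verts = h ` verts \<Gamma>, edges = (`) h ` edges \<Gamma>\<rparr>"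

definition graph_class :: "'a topology \<Rightarrow> 'a egraph \<Rightarrow> 'a egraph set" where
  "graph_class X \<Gamma> = (\<lambda>h. graph_image h \<Gamma>) ` Homeo0 X"


section \<open>Generic representatives and the crossing number\<close>

definition smooth_on :: "real set \<Rightarrow> (real \<Rightarrow> complex) \<Rightarrow> bool" where
  "smooth_on T c \<longleftrightarrow>
     (\<exists>D. (\<forall>t \<in> T. D 0 t = c t) \<and>
          (\<forall>n. \<forall>t \<in> T. (D n has_vector_derivative D (Suc n) t) (at t)))"

text \<open>
  Below, \<open>c\<close> is continuous, so the parameter set on which \<open>c\<close> runs inside a given
  chart domain is open and two-sided derivatives are meaningful.
\<close>

definition immersed_open_curve :: "'a rsurface \<Rightarrow> (real \<Rightarrow> 'a) \<Rightarrow> bool" where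
  "immersed_open_curve S c \<longleftrightarrow>
     (\<forall>(U, f) \<in> surf_charts S.
        let T = {t \<in> {0<..<1}. c t \<in> U}
        in smooth_on T (f \<circ> c) \<and> (\<forall>t \<in> T. vector_derivative (f \<circ> c) (at t) \<noteq> 0))"

definition transverse_at ::
    "'a rsurface \<Rightarrow> (real \<Rightarrow> 'a) \<Rightarrow> real \<Rightarrow> (real \<Rightarrow> 'a) \<Rightarrow> real \<Rightarrow> bool" where
  "transverse_at S c s d t \<longleftrightarrow>
     c s = d t \<and>
     (\<forall>(U, f) \<in> surf_charts S. c s \<in> U \<longrightarrow>
        \<not> collinear {0, vector_derivative (f \<circ> c) (at s), vector_derivative (f \<circ> d) (at t)})"

text \<open>
  An open edge carries no smooth structure of its own; the restriction of \<open>\<phi>\<close> to it is an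
  immersion if the edge has a parametrization \<open>\<gamma>\<close> for which \<open>\<phi> \<circ> \<gamma>\<close> is a smooth
  immersion. The singularities of the image are the points with more than one preimage in the
  graph.
\<close>

definition generic :: "'a rsurface \<Rightarrow> ('a \<Rightarrow> cp1) \<Rightarrow> 'a egraph \<Rightarrow> bool" where
  "generic Y \<phi> \<Gamma> \<longleftrightarrow>
     \<phi> ` graph_support \<Gamma> \<inter> \<phi> ` critical_points Y CP1 \<phi> = {} \<and>
     (\<exists>\<gamma>. (\<forall>e \<in> edges \<Gamma>. edge_param (surf_top Y) (verts \<Gamma>) e (\<gamma> e) \<and>
                         immersed_open_curve CP1 (\<phi> \<circ> \<gamma> e)) \<and>
          (\<forall>x \<in> graph_support \<Gamma>. \<forall>y \<in> graph_support \<Gamma>. x \<noteq> y \<and> \<phi> x = \<phi> y \<longrightarrow>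
             {z \<in> graph_support \<Gamma>. \<phi> z = \<phi> x} = {x, y} \<and>
             (\<exists>e \<in> edges \<Gamma>. \<exists>e' \<in> edges \<Gamma>. \<exists>s \<in> {0<..<1}. \<exists>t \<in> {0<..<1}.
                x = \<gamma> e s \<and> y = \<gamma> e' t \<and> transverse_at CP1 (\<phi> \<circ> \<gamma> e) s (\<phi> \<circ> \<gamma> e') t)))"

definition double_points :: "('a \<Rightarrow> cp1) \<Rightarrow> 'a egraph \<Rightarrow> cp1 set" where
  "double_points \<phi> \<Gamma> =
     {q. \<exists>x \<in> graph_support \<Gamma>. \<exists>y \<in> graph_support \<Gamma>. x \<noteq> y \<and> \<phi> x = q \<and> \<phi> y = q}"

definition generic_reps :: "'a rsurface \<Rightarrow> ('a \<Rightarrow> cp1) \<Rightarrow> 'a egraph set \<Rightarrow> 'a egraph set" where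
  "generic_reps Y \<phi> C = {\<Gamma> \<in> C. generic Y \<phi> \<Gamma>}"

text \<open>
  For generic \<open>\<Gamma>\<close> the set of double points is finite: they are isolated by
  transversality, and they do not accumulate at a point of the graph because \<open>\<phi>\<close> is locally
  injective there.
\<close>

definition crossings :: "('a \<Rightarrow> cp1) \<Rightarrow> 'a egraph \<Rightarrow> nat" where
  "crossings \<phi> \<Gamma> = card (double_points \<phi> \<Gamma>)"

definition min_crossings :: "'a rsurface \<Rightarrow> ('a \<Rightarrow> cp1) \<Rightarrow> 'a egraph set \<Rightarrow> nat" where
  "min_crossings Y \<phi> C = (LEAST n. n \<in> crossings \<phi> ` generic_reps Y \<phi> C)"

end

theory Submission
  imports Defs
begin

text \<open>
  The counterexample is a graph on the square torus \<open>Y\<close> with an even elliptic function \<open>\<phi>\<close> of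
  degree two, whose fibres are the pairs \<open>{z, - z}\<close>. The genus need not be computed: two graphs on the
  same \<open>Y\<close> with the same \<open>\<phi>\<close> have different crossing numbers, so one of these is not the genus.

  Both graphs have a single vertex and straight loops, one with the directions \<open>1\<close> and \<open>\<i>\<close>, the
  other with \<open>1\<close>, \<open>\<i>\<close> and \<open>1 + \<i>\<close>. Double points of the image under \<open>\<phi>\<close> come from
  intersections of the graph with its image under \<open>z \<mapsto> - z\<close>, and the straight representative of the
  first graph has just one.

  For the second graph, a homeomorphism homotopic to the identity lifts to a map \<open>H\<close> of the plane
  at bounded distance from the identity. Two lines of different directions \<open>d\<close>, \<open>d'\<close> are therefore
  sent by \<open>H\<close> and \<open>- H\<close> to curves that must meet. So every generic representative has a
  double point for every pair of loops, and those of the pairs \<open>(1, \<i>)\<close> and \<open>(1, 1 + \<i>)\<close>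
  are distinct because a fibre of \<open>\<phi>\<close> has only two points.
\<close>

section \<open>An even elliptic function of degree two\<close>

text \<open>The homeomorphism behind a representative is merely continuous, so the lower bound
  cannot rest on tangents or on intersection numbers of smooth curves; a fixed point argument in the
  plane replaces them. It finds a crossing somewhere on the closed loops, possibly many periods away
  or at the vertex; periodicity and genericity bring it back to open edges of the graph.

  Finiteness is the second obstacle: \<open>card\<close> is 0 on an infinite set, so two known
  double points bound the crossing number only once the set of all of them is finite. This is what
  transversality is used for.

  A loop need not cross its own reflection, so two loops force a crossing for a single pair only,
  and it takes a third direction to push the bound above one.

  Of the finer structure of the elliptic function two facts matter: its fibres are the classes of
  \<open>z\<close> and \<open>- z\<close> modulo the lattice, and it is unramified except where
  \<open>z\<close> and \<open>- z\<close> agree modulo the lattice.\<close>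

definition lat :: "complex set" where "lat = {z. Re z \<in> \<int> \<and> Im z \<in> \<int>}"

lemma lat_simps [simp]: "0 \<in> lat" "1 \<in> lat" "\<i> \<in> lat"
  by (auto simp: lat_def)

lemma lat_add [intro]: "x \<in> lat \<Longrightarrow> y \<in> lat \<Longrightarrow> x + y \<in> lat"
  and lat_diff [intro]: "x \<in> lat \<Longrightarrow> y \<in> lat \<Longrightarrow> x - y \<in> lat"
  and lat_minus_iff [simp]: "- x \<in> lat \<longleftrightarrow> x \<in> lat"
  by (auto simp: lat_def)

lemma of_int_lat [simp]: "of_int n \<in> lat" "\<i> * of_int n \<in> lat" "of_nat m \<in> lat" "\<i> * of_nat m \<in> lat"
  by (auto simp: lat_def)

lemma latE:
  assumes "z \<in> lat" obtains m n where "z = of_int m + \<i> * of_int n"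
  using assms by (force simp: lat_def complex_eq_iff elim!: Ints_cases)

lemma countable_lat: "countable lat"
proof -
  have "lat \<subseteq> range (\<lambda>(m::int, n::int). of_int m + \<i> * of_int n)"
    by (auto elim!: latE)
  then show ?thesis
    by (rule countable_subset) auto
qed

lemma lat_norm_less_1:
  assumes "z \<in> lat" "cmod z < 1" shows "z = 0"
proof -
  obtain m n where z: "z = of_int m + \<i> * of_int n"
    using assms(1) by (rule latE)
  have "\<bar>Re z\<bar> < 1" "\<bar>Im z\<bar> < 1"
    using assms(2) abs_Re_le_cmod[of z] abs_Im_le_cmod[of z] by linarith+
  then have "m = 0" "n = 0"
    unfolding z by simp_all
  then show ?thesis
    using z by simp
qed

lemma reduce_mod_lat: obtains l where "l \<in> lat" "z - l \<in> cbox 0 (1 + \<i>)"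
proof
  show "of_int \<lfloor>Re z\<rfloor> + \<i> * of_int \<lfloor>Im z\<rfloor> \<in> lat"
    by (intro lat_add) simp_all
  show "z - (of_int \<lfloor>Re z\<rfloor> + \<i> * of_int \<lfloor>Im z\<rfloor>) \<in> cbox 0 (1 + \<i>)"
    using of_int_floor_le[of "Re z"] of_int_floor_le[of "Im z"]
      real_of_int_floor_add_one_ge[of "Re z"] real_of_int_floor_add_one_ge[of "Im z"]
    by (auto simp: in_cbox_complex_iff; linarith)
qed

text \<open>
  \<open>ell y\<close> is the sum of \<open>cterm y (z + \<i> * n)\<close> over all integers \<open>n\<close>. As
  \<open>2 / (cos (2 * pi * y) - cos (2 * pi * w))\<close> equals
  \<open>1 / (sin (pi * (w - y)) * sin (pi * (w + y)))\<close>, this is up to a constant factor the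
  elliptic function with simple poles at \<open>y\<close> and \<open>- y\<close> and opposite residues. At a pole of a
  single term the convention \<open>1 / 0 = 0\<close> makes the value of \<open>ell y\<close> the sum of the other terms.
\<close>

definition cterm :: "complex \<Rightarrow> complex \<Rightarrow> complex" where
  "cterm y w = 1 / (cos (2 * of_real pi * y) - cos (2 * of_real pi * w))"

text \<open>Only one half of the sum, so that a single tail estimate high in the upper half plane
  suffices. As \<open>cterm\<close> is even, the terms of negative index at \<open>z\<close> are
  those of positive index at \<open>- z\<close>; adding both halves counts index 0 twice, which
  explains the subtraction in \<open>ell\<close>.\<close>

definition chalf :: "complex \<Rightarrow> complex \<Rightarrow> complex" where
  "chalf y z = suminf (\<lambda>n. cterm y (z + \<i> * of_nat n))"

definition ell :: "complex \<Rightarrow> complex \<Rightarrow> complex" where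
  "ell y z = chalf y z + chalf y (- z) - cterm y z"

section \<open>Convergence and periodicity of the series\<close>

lemma cterm_uminus [simp]: "cterm y (- w) = cterm y w"
  by (simp add: cterm_def)

lemma cos_2pi_eq_iff:
  "cos (2 * of_real pi * y) = cos (2 * of_real pi * w) \<longleftrightarrow>
     (\<exists>m::int. w = y + of_int m \<or> w = - y + of_int m)" for y w :: complex
proof -
  have eq: "2 * of_real pi * w = 2 * of_real pi * y + of_real (2 * of_int m * pi) \<longleftrightarrow> w = y + of_int m"
    "2 * of_real pi * w = - (2 * of_real pi * y) + of_real (2 * of_int m * pi) \<longleftrightarrow> w = - y + of_int m" for m
  proof -
    have eq: "2 * of_real pi * y + of_real (2 * of_int m * pi) = 2 * of_real pi * (y + of_int m)"
      "- (2 * of_real pi * y) + of_real (2 * of_int m * pi) = 2 * of_real pi * (- y + of_int m)"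
      by (simp_all add: algebra_simps)
    show "2 * of_real pi * w = 2 * of_real pi * y + of_real (2 * of_int m * pi) \<longleftrightarrow> w = y + of_int m"
      "2 * of_real pi * w = - (2 * of_real pi * y) + of_real (2 * of_int m * pi) \<longleftrightarrow> w = - y + of_int m"
      unfolding eq by (simp_all del: distrib_left_numeral)
  qed
  have "cos (2 * of_real pi * w) = cos (2 * of_real pi * y) \<longleftrightarrow>
     (\<exists>m::int. w = y + of_int m \<or> w = - y + of_int m)"
    unfolding complex_cos_eq Ints_def bex_simps image_iff by (simp only: eq)
  then show ?thesis by (simp only: eq_commute)
qed

lemma cos_2pi_add_int: "cos (2 * of_real pi * (w + of_int m)) = cos (2 * of_real pi * (w::complex))"
  using cos_2pi_eq_iff[of w "w + of_int m"] by auto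

text \<open>The reverse triangle inequality for the two exponentials gives
  \<open>sinh \<bar>Im w\<bar>\<close>, and the decaying one of them is at most 1.\<close>

lemma norm_cos_ge: "(exp \<bar>Im w\<bar> - 1) / 2 \<le> cmod (cos w)"
proof -
  have *: "(exp v - 1) / 2 \<le> cmod (cos w)" if "v = Im w \<or> v = - Im w" "v \<ge> 0" for v
  proof -
    have "cmod (exp (\<i> * w)) = exp (- Im w)" "cmod (exp (- (\<i> * w))) = exp (Im w)"
      by (simp_all add: norm_exp_eq_Re)
    moreover have "\<bar>cmod (exp (\<i> * w)) - cmod (exp (- (\<i> * w)))\<bar> \<le> cmod (exp (\<i> * w) + exp (- (\<i> * w)))"
      by (metis norm_minus_cancel norm_triangle_ineq3 diff_minus_eq_add)
    moreover have "exp (- v) \<le> 1"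
      using that by simp
    moreover have "2 * cmod (cos w) = cmod (exp (\<i> * w) + exp (- (\<i> * w)))"
      by (simp add: cos_exp_eq norm_divide)
    ultimately have "exp v - exp (- v) \<le> 2 * cmod (cos w)"
      using that(1) by auto
    then show ?thesis
      using order_trans[OF diff_left_mono[OF \<open>exp (- v) \<le> 1\<close>, of "exp v"]] by (simp add: mult.commute del: exp_le_one_iff)
  qed
  show ?thesis
    using *[of "\<bar>Im w\<bar>"] by (auto simp: abs_if)
qed

definition crad :: "complex \<Rightarrow> real" where
  "crad y = 1 + cmod (cos (2 * of_real pi * y))"

text \<open>In the imaginary direction the cosine grows exponentially; the quadratic Taylor
  polynomial of the exponential already gives a majorant that is summable and independent of
  \<open>z\<close>. The height \<open>crad y\<close> absorbs the cosine at \<open>y\<close> and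
  provides the \<open>+ 1\<close> of the majorant.\<close>

lemma cterm_bound:
  assumes "Im z \<ge> crad y"
  shows "cos (2 * of_real pi * y) \<noteq> cos (2 * of_real pi * (z + \<i> * of_nat n))"
    and "cmod (cterm y (z + \<i> * of_nat n)) \<le> 1 / (real n + 1)^2"
proof -
  define C where "C = cmod (cos (2 * of_real pi * y))"
  define u where "u = 2 * of_real pi * (z + \<i> * of_nat n)"
  define m where "m = real n + 1 + C"
  have m: "m \<ge> 1" "C \<ge> 0" by (auto simp: m_def C_def)
  have "Im u = 2 * pi * (Im z + real n)"
    by (simp add: u_def)
  moreover have "Im z + real n \<ge> m"
    using assms by (simp add: m_def crad_def C_def)
  moreover have "(2 * pi) * (Im z + real n) \<ge> 6 * m"
    using m calculation pi_gt3 by (intro mult_mono) auto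
  ultimately have u: "Im u \<ge> 6 * m" by simp
  have "exp \<bar>Im u\<bar> \<ge> exp (6 * m)"
    using u m by auto
  also have "exp (6 * m) \<ge> 1 + 6 * m + (6 * m)\<^sup>2 / 2"
    using m by (intro exp_lower_Taylor_quadratic) auto
  finally have "exp \<bar>Im u\<bar> \<ge> 1 + 6 * m + (6 * m)\<^sup>2 / 2" .
  then have "(exp \<bar>Im u\<bar> - 1)/2 \<ge> 3 * m + 9 * m\<^sup>2"
    by (simp add: power2_eq_square)
  then have "cmod (cos u) \<ge> 3 * m + 9 * m\<^sup>2"
    using norm_cos_ge[of u] by linarith
  moreover have "cmod (cos u) - C \<le> cmod (cos (2 * of_real pi * y) - cos u)"
    unfolding C_def by (metis norm_minus_commute norm_triangle_ineq2)
  moreover have "m\<^sup>2 \<ge> (real n + 1)\<^sup>2"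
    using m by (intro power_mono) (auto simp: m_def)
  moreover have "m \<ge> C" "m\<^sup>2 \<ge> 0" by (auto simp: m_def)
  ultimately have D: "cmod (cos (2 * of_real pi * y) - cos u) \<ge> (real n + 1)\<^sup>2"
    using m by linarith
  moreover have pos: "(real n + 1)\<^sup>2 > 0" by simp
  ultimately show "cos (2 * of_real pi * y) \<noteq> cos (2 * of_real pi * (z + \<i> * of_nat n))"
    by (auto simp: u_def)
  show "cmod (cterm y (z + \<i> * of_nat n)) \<le> 1 / (real n + 1)^2"
    using D pos by (simp add: cterm_def norm_divide frac_le flip: u_def)
qed

lemma summable_inverse_Suc_squares: "summable (\<lambda>n. 1 / (real n + 1)^2)"
  using inverse_squares_sums by (simp add: sums_iff add.commute)

lemma chalf_holomorphic: "chalf y holomorphic_on {z. crad y < Im z}"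
proof -
  let ?A = "{z. crad y < Im z}"
  let ?f = "\<lambda>n z. cterm y (z + \<i> * of_nat n)"
  have op: "open ?A" by (simp add: open_halfspace_Im_gt)
  have lim: "uniform_limit ?A (\<lambda>n z. \<Sum>i<n. ?f i z) (\<lambda>z. suminf (\<lambda>i. ?f i z)) sequentially"
  proof (rule Weierstrass_m_test[OF _ summable_inverse_Suc_squares])
    fix n z assume "z \<in> ?A"
    then show "norm (?f n z) \<le> 1 / (real n + 1)^2"
      by (intro cterm_bound(2)) simp
  qed
  have hol: "?f n holomorphic_on ?A" for n
  proof -
    have "\<forall>z\<in>?A. cos (2 * of_real pi * y) - cos (2 * of_real pi * (z + \<i> * of_nat n)) \<noteq> 0"
      using cterm_bound(1) by simp
    then show ?thesis
      unfolding cterm_def by (intro holomorphic_intros) blast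
  qed
  have "(\<lambda>z. suminf (\<lambda>i. ?f i z)) holomorphic_on ?A"
  proof (rule holomorphic_uniform_sequence[OF op])
    show "(\<lambda>z. \<Sum>i<n. ?f i z) holomorphic_on ?A" for n
      by (intro holomorphic_on_sum hol)
    fix x assume "x \<in> ?A"
    then obtain d where d: "d > 0" "cball x d \<subseteq> ?A"
      using op open_contains_cball by blast
    show "\<exists>d>0. cball x d \<subseteq> ?A \<and> uniform_limit (cball x d) (\<lambda>n z. \<Sum>i<n. ?f i z)
      (\<lambda>z. suminf (\<lambda>i. ?f i z)) sequentially"
      using d uniform_limit_on_subset[OF lim d(2)] by blast
  qed
  then show ?thesis
    unfolding chalf_def .
qed

text \<open>There is no condition on \<open>z\<close>: only finitely many terms lie below the height
  \<open>crad y\<close>, and even a singular one has a value by \<open>1 / 0 = 0\<close>.\<close>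

lemma summable_cterm: "summable (\<lambda>n. cterm y (z + \<i> * of_nat n))"
proof -
  obtain N :: nat where N: "real N \<ge> crad y - Im z"
    using real_arch_simple by blast
  have "summable (\<lambda>n. cterm y ((z + \<i> * of_nat N) + \<i> * of_nat n))"
    using cterm_bound(2)[of y "z + \<i> * of_nat N"] N
    by (intro summable_comparison_test'[OF summable_inverse_Suc_squares, of 0]) auto
  then show ?thesis
    by (subst summable_iff_shift[of _ N, symmetric]) (simp add: algebra_simps)
qed

lemma chalf_split:
  "chalf y z = (\<Sum>n<N. cterm y (z + \<i> * of_nat n)) + chalf y (z + \<i> * of_nat N)"
  unfolding chalf_def using suminf_split_initial_segment[OF summable_cterm, of y z N]
  by (simp add: algebra_simps)

lemma chalf_step: "chalf y z = cterm y z + chalf y (z + \<i>)"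
  using chalf_split[of y z 1] by simp

lemma ell_uminus [simp]: "ell y (- z) = ell y z"
  by (simp add: ell_def)

text \<open>The shift takes \<open>cterm y z\<close> from one half and adds
  \<open>cterm y (z + \<i>)\<close> to the other; the change of the subtracted term makes up for
  both. This is a finite rearrangement, hence valid at poles too.\<close>

lemma ell_add_i: "ell y (z + \<i>) = ell y z"
proof -
  have "cterm y (- z - \<i>) = cterm y (z + \<i>)"
    using cterm_uminus[of y "z + \<i>"] by (simp only: minus_add_distrib diff_conv_add_uminus)
  moreover have "chalf y (- z - \<i>) = cterm y (- z - \<i>) + chalf y (- z)"
    using chalf_step[of y "- z - \<i>"] by (simp only: diff_add_cancel)
  moreover have "- (z + \<i>) = - z - \<i>"
    by simp
  ultimately show ?thesis
    unfolding ell_def chalf_step[of y z] by (simp only:) simp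
qed

lemma cterm_add_int: "cterm y (z + of_int m) = cterm y z"
  by (simp add: cterm_def cos_2pi_add_int)

lemma chalf_add_int: "chalf y (z + of_int m) = chalf y z"
proof -
  have "cterm y (z + of_int m + \<i> * of_nat n) = cterm y (z + \<i> * of_nat n)" for n
    using cterm_add_int[of y "z + \<i> * of_nat n" m] by (simp add: ac_simps)
  then show ?thesis
    by (simp add: chalf_def)
qed

lemma ell_add_int: "ell y (z + of_int m) = ell y z"
proof -
  have "- (z + of_int m) = - z + of_int (- m)"
    by simp
  then show ?thesis
    by (simp only: ell_def chalf_add_int cterm_add_int)
qed

lemma ell_periodic:
  assumes "l \<in> lat" shows "ell y (z + l) = ell y z"
proof -
  have nat: "ell y (z + \<i> * of_nat n) = ell y z" for n z
  proof (induction n)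
    case (Suc n)
    have "z + \<i> * of_nat (Suc n) = (z + \<i> * of_nat n) + \<i>"
      by (simp add: algebra_simps)
    then show ?case
      by (simp only: ell_add_i Suc.IH)
  qed simp
  have int: "ell y (z + \<i> * of_int n) = ell y z" for n z
  proof (cases n rule: int_cases2)
    case (nonneg k)
    then show ?thesis by (simp only: of_int_of_nat_eq nat)
  next
    case (nonpos k)
    have "z = (z + \<i> * of_int n) + \<i> * of_nat k"
      by (simp add: nonpos)
    then show ?thesis using nat by metis
  qed
  obtain m n where l: "l = of_int m + \<i> * of_int n" using assms by (rule latE)
  have "z + l = (z + of_int m) + \<i> * of_int n"
    by (simp add: l)
  then show ?thesis by (simp only: int ell_add_int)
qed

section \<open>Classes of points up to sign and lattice translation\<close>

text \<open>The points equivalent to their own negatives modulo the lattice. They are the fixed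
  points of the involution on the torus and will be the ramification points of the function.\<close>

definition half_lat :: "complex set" where "half_lat = {z. 2 * z \<in> lat}"

definition pm :: "complex \<Rightarrow> complex set" where "pm y = {z. z - y \<in> lat \<or> z + y \<in> lat}"

lemma pm_refl [simp]: "y \<in> pm y" "- y \<in> pm y"
  by (auto simp: pm_def)

lemma pm_sym: "z \<in> pm y \<longleftrightarrow> y \<in> pm z"
proof -
  have "z - y \<in> lat \<longleftrightarrow> y - z \<in> lat"
    by (metis lat_minus_iff minus_diff_eq)
  then show ?thesis
    by (simp add: pm_def add.commute)
qed

lemma pm_trans:
  assumes "x \<in> pm y" "y \<in> pm z" shows "x \<in> pm z"
proof -
  consider "x - y \<in> lat" "y - z \<in> lat" | "x - y \<in> lat" "y + z \<in> lat"
    | "x + y \<in> lat" "y - z \<in> lat" | "x + y \<in> lat" "y + z \<in> lat"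
    using assms by (auto simp: pm_def)
  then show ?thesis
  proof cases
    case 1 then show ?thesis using lat_add[of "x - y" "y - z"] by (simp add: pm_def)
  next
    case 2 then show ?thesis using lat_add[of "x - y" "y + z"] by (simp add: pm_def)
  next
    case 3 then show ?thesis using lat_diff[of "x + y" "y - z"] by (simp add: pm_def)
  next
    case 4 then show ?thesis using lat_diff[of "x + y" "y + z"] by (simp add: pm_def)
  qed
qed

lemma half_lat_pm: 
  assumes "z \<in> pm y" shows "z \<in> half_lat \<longleftrightarrow> y \<in> half_lat"
proof -
  have *: "y' \<in> half_lat" if z: "z' \<in> pm y'" "z' \<in> half_lat" for z' y'
  proof -
    consider "z' - y' \<in> lat" | "z' + y' \<in> lat"
      using z by (auto simp: pm_def)
    then show ?thesis
    proof cases
      case 1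
      then have "2 * z' - ((z' - y') + (z' - y')) \<in> lat"
        using z(2) by (intro lat_add[of "z' - y'" "z' - y'"] lat_diff[of "2 * z'"]) (auto simp: half_lat_def)
      then show ?thesis by (simp add: half_lat_def)
    next
      case 2
      then have "((z' + y') + (z' + y')) - 2 * z' \<in> lat"
        using z(2) by (intro lat_add[of "z' + y'" "z' + y'"] lat_diff[of _ "2 * z'"]) (auto simp: half_lat_def)
      then show ?thesis by (simp add: half_lat_def)
    qed
  qed
  show ?thesis
    using *[of z y] *[of y z] assms pm_sym by blast
qed

lemma ell_pm: "z \<in> pm w \<Longrightarrow> ell y z = ell y w"
  using ell_periodic[of "z - w" y w] ell_periodic[of "z + w" y "- w"] by (auto simp: pm_def)

lemma closed_subset_lat: "S \<subseteq> lat \<Longrightarrow> closed S"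
  by (rule discrete_imp_closed[of 1])
     (simp, metis dist_norm eq_iff_diff_eq_0 lat_diff lat_norm_less_1 subset_iff)

lemma closed_pm: "closed (pm y)"
proof -
  have "pm y = (\<lambda>z. z - y) -` lat \<union> (\<lambda>z. z + y) -` lat"
    by (simp add: pm_def vimage_def Collect_disj_eq)
  moreover have "closed ((\<lambda>z. z - y) -` lat)" "closed ((\<lambda>z. z + y) -` lat)"
    by (rule closed_vimage[OF closed_subset_lat[OF order_refl]]; intro continuous_intros)+
  ultimately show ?thesis
    by (simp only: closed_Un)
qed

lemma eventually_notin_lat: "\<forall>\<^sub>F z in at p. z \<notin> lat"
proof -
  have "open (- (lat - {p}))" "p \<in> - (lat - {p})"
    using closed_subset_lat[of "lat - {p}"] by (auto simp only: open_Compl Diff_subset Diff_iff Compl_iff)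
  then have "\<forall>\<^sub>F z in nhds p. z \<in> - (lat - {p})"
    by (rule eventually_nhds_in_open)
  then show ?thesis
    by (auto simp: eventually_at_filter elim: eventually_mono)
qed

lemma eventually_notin_pm: "\<forall>\<^sub>F z in at p. z \<notin> pm y"
proof -
  have *: "\<forall>\<^sub>F z in at p. z + c \<notin> lat" for c
    using eventually_notin_lat[of "p + c"] eventually_at_to_0[of _ p] eventually_at_to_0[of _ "p + c"]
    by (simp add: add.assoc)
  show ?thesis
    using *[of y] *[of "- y"] by eventually_elim (auto simp: pm_def)
qed

lemma notin_pm_imp_cos_neq:
  assumes "z \<notin> pm y"
  shows "cos (2 * of_real pi * y) \<noteq> cos (2 * of_real pi * (z + \<i> * of_int n))"
proof
  assume "cos (2 * of_real pi * y) = cos (2 * of_real pi * (z + \<i> * of_int n))"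
  then obtain m where "z + \<i> * of_int n = y + of_int m \<or> z + \<i> * of_int n = - y + of_int m"
    unfolding cos_2pi_eq_iff by blast
  then have "z - y = of_int m - \<i> * of_int n \<or> z + y = of_int m - \<i> * of_int n"
    by (auto simp: algebra_simps)
  moreover have "of_int m - \<i> * of_int n \<in> lat"
    by (intro lat_diff) simp_all
  ultimately show False
    using assms by (auto simp: pm_def)
qed

section \<open>Analytic points and simple poles\<close>

lemma ell_split:
  "ell y z = (\<Sum>n\<in>{- int (Suc M)<..<int (Suc M)}. cterm y (z + \<i> * of_int n)) +
     (chalf y (z + \<i> * of_nat (Suc M)) + chalf y (- z + \<i> * of_nat (Suc M)))"
proof (induction M)
  case 0
  have "{- 1<..<1} = {0::int}" by auto
  then show ?case
    using chalf_step[of y z] chalf_step[of y "- z"] by (simp add: ell_def)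
next
  case (Suc M)
  have set: "{- int (Suc (Suc M))<..<int (Suc (Suc M))} =
    insert (int (Suc M)) (insert (- int (Suc M)) {- int (Suc M)<..<int (Suc M)})"
    by auto
  have "(\<Sum>n\<in>{- int (Suc (Suc M))<..<int (Suc (Suc M))}. cterm y (z + \<i> * of_int n)) =
    cterm y (z + \<i> * of_nat (Suc M)) + cterm y (z - \<i> * of_nat (Suc M)) +
    (\<Sum>n\<in>{- int (Suc M)<..<int (Suc M)}. cterm y (z + \<i> * of_int n))"
    unfolding set by (subst sum.insert, simp, simp, subst sum.insert) (simp_all add: algebra_simps)
  moreover have "cterm y (z - \<i> * of_nat (Suc M)) = cterm y (- z + \<i> * of_nat (Suc M))"
    using cterm_uminus[of y "z - \<i> * of_nat (Suc M)"] by simp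
  moreover have "chalf y (z + \<i> * of_nat (Suc M)) =
      cterm y (z + \<i> * of_nat (Suc M)) + chalf y (z + \<i> * of_nat (Suc (Suc M)))"
    "chalf y (- z + \<i> * of_nat (Suc M)) =
      cterm y (- z + \<i> * of_nat (Suc M)) + chalf y (- z + \<i> * of_nat (Suc (Suc M)))"
    using chalf_step[of y "z + \<i> * of_nat (Suc M)"] chalf_step[of y "- z + \<i> * of_nat (Suc M)"]
    by (simp_all add: algebra_simps)
  moreover have "a = s' + (c1' + c2')"
    if "s' = t1 + t0 + s" "t0 = t2" "c1 = t1 + c1'" "c2 = t2 + c2'" "a = s + (c1 + c2)"
    for a s s' c1 c2 c1' c2' t0 t1 t2 :: complex
    using that by simp
  ultimately show ?case
    using Suc.IH by blast
qed

text \<open>Near \<open>p\<close> both tails of the sum stay above the height \<open>crad y\<close>,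
  where \<open>chalf\<close> is analytic. The index \<open>n0\<close> is forced into the finite part
  so that a singular term can be singled out later.\<close>

lemma ell_local:
  obtains I :: "int set" and A where "finite I" "n0 \<in> I" "A analytic_on {p}"
    "\<And>z. ell y z = (\<Sum>n\<in>I. cterm y (z + \<i> * of_int n)) + A z"
proof -
  obtain M :: nat where M: "real M \<ge> \<bar>crad y\<bar> + \<bar>Im p\<bar> + \<bar>of_int n0\<bar>"
    using real_arch_simple by blast
  have op: "open {z. crad y < Im z}" by (simp add: open_halfspace_Im_gt)
  have an: "chalf y analytic_on {z. crad y < Im z}"
    using chalf_holomorphic op by (simp add: analytic_on_open)
  have 1: "(chalf y \<circ> (\<lambda>z. z + \<i> * of_nat (Suc M))) analytic_on {p}"
    using M by (intro analytic_on_compose analytic_intros analytic_on_subset[OF an]) auto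
  have 2: "(chalf y \<circ> (\<lambda>z. - z + \<i> * of_nat (Suc M))) analytic_on {p}"
    using M by (intro analytic_on_compose analytic_intros analytic_on_subset[OF an]) auto
  have "(\<lambda>z. chalf y (z + \<i> * of_nat (Suc M)) + chalf y (- z + \<i> * of_nat (Suc M))) analytic_on {p}"
    using analytic_on_add[OF 1 2] by (simp add: o_def)
  moreover have "n0 \<in> {- int (Suc M)<..<int (Suc M)}"
    using M by auto
  ultimately show ?thesis
    by (intro that[OF _ _ _ ell_split]) simp_all
qed

lemma ell_analytic:
  assumes "p \<notin> pm y" shows "ell y analytic_on {p}"
proof -
  obtain I and A where I: "finite I" "0 \<in> I" "A analytic_on {p}"
    "\<And>z. ell y z = (\<Sum>n\<in>I. cterm y (z + \<i> * of_int n)) + A z"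
    by (rule ell_local[of 0 p y]) (rule that; blast)
  have "ell y = (\<lambda>z. (\<Sum>n\<in>I. cterm y (z + \<i> * of_int n)) + A z)"
    by (rule ext) (rule I(4))
  moreover have "(\<lambda>z. (\<Sum>n\<in>I. cterm y (z + \<i> * of_int n)) + A z) analytic_on {p}"
    using notin_pm_imp_cos_neq[OF assms] unfolding cterm_def
    by (intro analytic_intros I(3)) simp
  ultimately show ?thesis by simp
qed

text \<open>Exactly one term of the series is singular at \<open>p\<close>. Its denominator is
  \<open>D\<close>, whose derivative is a multiple of a sine that could vanish only if
  \<open>p\<close> were in \<open>half_lat\<close>. The formula holds at \<open>p\<close> as well,
  by \<open>1 / 0 = 0\<close> on both sides.\<close>

lemma ell_pole:
  assumes "p \<in> pm y" "y \<notin> half_lat"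
  obtains D B where "D analytic_on {p}" "B analytic_on {p}" "D p = 0" "deriv D p \<noteq> 0"
    "\<And>z. ell y z = 1 / D z + B z"
proof -
  have p: "p \<notin> half_lat"
    using assms half_lat_pm by blast
  let ?P = "\<lambda>n::int. cos (2 * of_real pi * y) = cos (2 * of_real pi * (p + \<i> * of_int n))"
  have "\<exists>n0. ?P n0"
  proof -
    have "\<exists>m n. p - y = of_int m + \<i> * of_int n \<or> p + y = of_int m + \<i> * of_int n"
      using assms(1) unfolding pm_def mem_Collect_eq by (metis latE)
    then obtain m n where "p - y = of_int m + \<i> * of_int n \<or> p + y = of_int m + \<i> * of_int n"
      by blast
    then have "p + \<i> * of_int (- n) = y + of_int m \<or> p + \<i> * of_int (- n) = - y + of_int m"
      by (auto simp: algebra_simps)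
    then show ?thesis
      unfolding cos_2pi_eq_iff by blast
  qed
  then obtain n0 where n0: "?P n0" by blast
  \<comment> \<open>If both indices belong to the same sign of \<open>y\<close>, then
    \<open>\<i> * (n - n0)\<close> is real and hence 0; if to opposite signs, the sum of the two
    equations puts \<open>2 * p\<close> into the lattice.\<close>
  have uniq: "n = n0" if n: "?P n" for n
  proof -
    have 1: "\<exists>m. p + \<i> * of_int n = y + of_int m \<or> p + \<i> * of_int n = - y + of_int m"
      using n unfolding cos_2pi_eq_iff .
    have 2: "\<exists>m. p + \<i> * of_int n0 = y + of_int m \<or> p + \<i> * of_int n0 = - y + of_int m"
      using n0 unfolding cos_2pi_eq_iff .
    from 1 2 obtain m m0 where m: "p + \<i> * of_int n = y + of_int m \<or> p + \<i> * of_int n = - y + of_int m"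
      "p + \<i> * of_int n0 = y + of_int m0 \<or> p + \<i> * of_int n0 = - y + of_int m0"
      by blast
    have "\<i> * of_int n - \<i> * of_int n0 = of_int m - of_int m0 \<or> 
      2 * p = of_int m + of_int m0 - (\<i> * of_int n + \<i> * of_int n0)"
      using m by (elim disjE) ((rule disjI1, simp add: complex_eq_iff; fail) | (rule disjI2, simp add: complex_eq_iff; fail))+
    moreover have "2 * p \<noteq> of_int m + of_int m0 - (\<i> * of_int n + \<i> * of_int n0)"
      using p unfolding half_lat_def mem_Collect_eq by (metis lat_add lat_diff of_int_lat(1,2))
    ultimately show "n = n0"
      by (auto simp: complex_eq_iff)
  qed
  obtain I and A where I: "finite I" "n0 \<in> I" "A analytic_on {p}"
    "\<And>z. ell y z = (\<Sum>n\<in>I. cterm y (z + \<i> * of_int n)) + A z"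
    by (rule ell_local[of n0 p y]) (rule that; blast)
  define D where "D = (\<lambda>z. cos (2 * of_real pi * y) - cos (2 * of_real pi * (z + \<i> * of_int n0)))"
  define B where "B = (\<lambda>z. (\<Sum>n\<in>I-{n0}. cterm y (z + \<i> * of_int n)) + A z)"
  have "B analytic_on {p}"
    unfolding B_def cterm_def using uniq by (intro analytic_intros I(3)) auto
  moreover have "D analytic_on {p}"
    unfolding D_def by (intro analytic_intros)
  moreover have "D p = 0"
    using n0 by (simp add: D_def)
  moreover have "deriv D p \<noteq> 0"
  proof
    define u where "u = 2 * of_real pi * (p + \<i> * of_int n0)"
    have "(D has_field_derivative 2 * of_real pi * sin u) (at p)"
      unfolding D_def u_def by (auto intro!: derivative_eq_intros)
    moreover assume "deriv D p = 0"
    ultimately have "sin u = 0"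
      using DERIV_imp_deriv by fastforce
    then obtain k where "u = of_real (real_of_int k * pi)"
      by (auto simp: sin_eq_0)
    then have "2 * of_real pi * (p + \<i> * of_int n0) = of_real pi * of_int k"
      by (simp add: u_def)
    then have "of_real pi * (2 * p) = of_real pi * (of_int k - 2 * (\<i> * of_int n0))"
      by (simp add: algebra_simps)
    then have "2 * p = of_int k - (\<i> * of_int n0 + \<i> * of_int n0)"
      by simp
    then show False
      using p unfolding half_lat_def mem_Collect_eq by (metis lat_add lat_diff of_int_lat(1,2))
  qed
  moreover have "ell y z = 1 / D z + B z" for z
    using I(1,2) unfolding I(4) by (simp add: B_def D_def cterm_def sum.remove)
  ultimately show ?thesis
    using that by blast
qed

lemma analytic_zero_factor:
  assumes "f analytic_on {p}" "f p = (0::complex)"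
  obtains g where "g analytic_on {p}" "g p = deriv f p" "\<And>z. f z = (z - p) * g z"
proof
  define g where "g = (\<lambda>z. if z = p then deriv f p else f z / (z - p))"
  show "g analytic_on {p}"
    by (rule pole_theorem_analytic_0[OF assms(1), where a = p])
       (auto simp: g_def assms(2) intro: exI[of _ 1])
  show "g p = deriv f p" by (simp add: g_def)
  show "f z = (z - p) * g z" for z by (simp add: g_def assms(2))
qed

lemma eventually_simple_zero_neq_0:
  assumes "D analytic_on {p}" "D p = 0" "deriv D p \<noteq> (0::complex)"
  shows "\<forall>\<^sub>F z in at p. D z \<noteq> 0"
proof -
  obtain d where d: "d analytic_on {p}" "d p \<noteq> 0" "\<And>z. D z = (z - p) * d z"
    using analytic_zero_factor[OF assms(1,2)] assms(3) by metis
  have "\<forall>\<^sub>F z in at p. d z \<noteq> 0"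
    using analytic_at_imp_isCont[OF d(1)] d(2) unfolding isCont_def by (rule tendsto_imp_eventually_ne)
  then show ?thesis
    using eventually_neq_at_within[of p p] by eventually_elim (simp add: d(3))
qed

text \<open>The equation is confined to a punctured neighbourhood: at \<open>p\<close> itself the
  left side is 0 by \<open>1 / 0 = 0\<close>, whereas \<open>q p\<close> is the quotient of the
  derivatives of \<open>E\<close> and \<open>D\<close>.\<close>

lemma simple_pole_times_zero:
  assumes "D analytic_on {p}" "B analytic_on {p}" "D p = 0" "deriv D p \<noteq> 0"
    and "E analytic_on {p}" "E p = (0::complex)"
  obtains q where "q analytic_on {p}" "\<forall>\<^sub>F z in at p. (1 / D z + B z) * E z = q z"
proof -
  obtain d where d: "d analytic_on {p}" "d p \<noteq> 0" "\<And>z. D z = (z - p) * d z"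
    using analytic_zero_factor[OF assms(1,3)] assms(4) by metis
  obtain e where e: "e analytic_on {p}" "\<And>z. E z = (z - p) * e z"
    using analytic_zero_factor[OF assms(5,6)] by metis
  have "(\<lambda>z. e z / d z + B z * E z) analytic_on {p}"
    using assms d(1,2) e(1) by (intro analytic_intros) auto
  moreover have "(1 / D z + B z) * E z = e z / d z + B z * E z" if "z \<noteq> p" for z
    using that unfolding d(3) e(2) by (cases "d z = 0") (simp_all add: field_simps)
  then have "\<forall>\<^sub>F z in at p. (1 / D z + B z) * E z = e z / d z + B z * E z"
    by (simp add: eventually_at_filter)
  ultimately show ?thesis by (rule that)
qed

text \<open>
  Each factor of \<open>ellprod b y\<close> vanishes at the simple poles of the other one, so the product extends to
  a bounded entire function. Its being a nonzero constant replaces the theory of the degree of \<open>ell b\<close>.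
\<close>

definition ellprod :: "complex \<Rightarrow> complex \<Rightarrow> complex \<Rightarrow> complex" where
  "ellprod b y z = (ell b z - ell b y) * (ell y z - ell y b)"

section \<open>The constant product and its consequences for the fibres\<close>

lemma ellprod_local:
  assumes "b \<notin> half_lat" "y \<notin> half_lat" "y \<notin> pm b"
  obtains q where "q analytic_on {p}" "\<forall>\<^sub>F z in at p. ellprod b y z = q z"
proof -
  \<comment> \<open>Exchanging \<open>b\<close> and \<open>y\<close> exchanges the two factors, so
    one computation treats the poles of either.\<close>
  have *: "\<exists>q. q analytic_on {p} \<and> (\<forall>\<^sub>F z in at p. (ell c z - ell c x) * (ell x z - ell x c) = q z)"
    if p: "p \<in> pm c" and c: "c \<notin> half_lat" "x \<notin> pm c" for c x
  proof -
    have "p \<notin> pm x"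
      using p c pm_sym pm_trans by blast
    then have E: "(\<lambda>z. ell x z - ell x c) analytic_on {p}"
      by (intro analytic_intros ell_analytic)
    have E0: "ell x p - ell x c = 0"
      using p ell_pm by simp
    obtain D B where D: "D analytic_on {p}" "B analytic_on {p}" "D p = 0" "deriv D p \<noteq> 0"
      and eq: "\<And>z. ell c z = 1 / D z + B z"
      using ell_pole[OF p c(1)] by blast
    have B: "(\<lambda>z. B z - ell c x) analytic_on {p}"
      using D by (intro analytic_intros)
    obtain q where "q analytic_on {p}"
      "\<forall>\<^sub>F z in at p. (1 / D z + (B z - ell c x)) * (ell x z - ell x c) = q z"
      using simple_pole_times_zero[OF D(1) B D(3,4) E E0] by blast
    then show ?thesis
      unfolding eq[abs_def] by (auto simp: add_diff_eq)
  qed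
  consider "p \<in> pm b" | "p \<in> pm y" | "p \<notin> pm b" "p \<notin> pm y" by blast
  then show ?thesis
  proof cases
    case 1
    then show ?thesis
      using *[of b y] assms that unfolding ellprod_def by blast
  next
    case 2
    moreover have "b \<notin> pm y"
      using assms pm_sym by blast
    ultimately show ?thesis
      using *[of y b] assms that unfolding ellprod_def by (auto simp: mult.commute)
  next
    case 3
    then have "ellprod b y analytic_on {p}"
      unfolding ellprod_def by (intro analytic_intros ell_analytic)
    then show ?thesis
      by (rule that) simp
  qed
qed

text \<open>The limit is needed at all points near \<open>p\<close>, not only at \<open>p\<close>:
  the function formed by the limits has to agree with \<open>q\<close> on a whole neighbourhood in
  order to be analytic.\<close>

lemma eventually_at_extend_analytic:
  fixes f :: "complex \<Rightarrow> complex"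
  assumes "q analytic_on {p}" "\<forall>\<^sub>F z in at p. f z = q z"
  shows "\<forall>\<^sub>F w in nhds p. (f \<longlongrightarrow> q w) (at w)"
proof -
  obtain S where S: "open S" "p \<in> S" "\<And>z. z \<in> S \<Longrightarrow> z \<noteq> p \<Longrightarrow> f z = q z"
    using assms(2) unfolding eventually_at_filter eventually_nhds by blast
  obtain T where T: "open T" "p \<in> T" "q holomorphic_on T"
    using assms(1) unfolding analytic_at by blast
  have "(f \<longlongrightarrow> q w) (at w)" if w: "w \<in> S \<inter> T" for w
  proof -
    have "\<forall>\<^sub>F z in at w. z \<in> S - {p} \<or> (w = p \<and> z \<in> S - {w})"
    proof (cases "w = p")
      case True
      then show ?thesis
        using eventually_at_in_open[OF S(1,2)] by (auto elim: eventually_mono)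
    next
      case False
      then show ?thesis
        using eventually_at_in_open'[of "S - {p}" w] S(1) w by (auto elim: eventually_mono)
    qed
    then have "\<forall>\<^sub>F z in at w. q z = f z"
      by eventually_elim (use S(3) in auto)
    moreover have "(q \<longlongrightarrow> q w) (at w)"
      using T w holomorphic_on_imp_continuous_on[OF T(3)] continuous_on_eq_continuous_at[OF T(1)]
      by (auto simp: isCont_def)
    ultimately show ?thesis
      using Lim_transform_eventually by blast
  qed
  then show ?thesis
    using S(1,2) T(1,2) by (intro eventually_nhds[THEN iffD2] exI[of _ "S \<inter> T"]) auto
qed

text \<open>Where \<open>D z\<close> is nonzero, \<open>D z * (ell y z - c)\<close> equals
  \<open>1 + D z * (B z - c)\<close>, which tends to 1 at the pole.\<close>

lemma ell_neq_near_pole: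
  assumes "p \<in> pm y" "y \<notin> half_lat" shows "\<forall>\<^sub>F z in at p. ell y z \<noteq> c"
proof -
  obtain D B where D: "D analytic_on {p}" "B analytic_on {p}" "D p = 0" "deriv D p \<noteq> 0"
    and eq: "\<And>z. ell y z = 1 / D z + B z"
    using ell_pole[OF assms] by blast
  obtain d where d: "d analytic_on {p}" "d p \<noteq> 0" "\<And>z. D z = (z - p) * d z"
    using analytic_zero_factor[OF D(1,3)] D(4) by metis
  have cont: "isCont d p" "isCont B p"
    using d(1) D(2) analytic_at_imp_isCont by blast+
  have "((\<lambda>z. 1 + (z - p) * d z * (B z - c)) \<longlongrightarrow> 1 + (p - p) * d p * (B p - c)) (at p)"
    using cont unfolding isCont_def by (intro tendsto_intros)
  then have "\<forall>\<^sub>F z in at p. 1 + (z - p) * d z * (B z - c) \<noteq> 0"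
    by (rule tendsto_imp_eventually_ne) simp
  moreover have "\<forall>\<^sub>F z in at p. d z \<noteq> 0"
    using cont(1) d(2) unfolding isCont_def by (rule tendsto_imp_eventually_ne)
  ultimately show ?thesis
    using eventually_neq_at_within[of p p]
  proof eventually_elim
    case (elim z)
    then have "D z \<noteq> 0"
      by (simp add: d(3))
    then have "1 + D z * (B z - c) = D z * (ell y z - c)"
      by (simp add: eq algebra_simps)
    then have "1 + (z - p) * d z * (B z - c) = (z - p) * d z * (ell y z - c)"
      by (simp only: d(3))
    then show ?case
      using elim(1) by auto
  qed
qed

text \<open>Deleting the countable set \<open>pm y\<close> leaves the plane connected, so by the
  identity theorem a local constant would be the value everywhere, against the pole at
  \<open>y\<close>.\<close>

lemma ell_not_locally_constant:
  assumes "y \<notin> half_lat" "p \<notin> pm y" "\<forall>\<^sub>F z in at p. ell y z = c" shows False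
proof -
  have op: "open (- pm y)"
    using closed_pm by blast
  have "countable (pm y)"
  proof -
    have "pm y \<subseteq> (+) y ` lat \<union> (\<lambda>z. z - y) ` lat"
    proof
      fix z assume "z \<in> pm y"
      then have "z - y \<in> lat \<or> z + y \<in> lat" "z = y + (z - y)" "z = (z + y) - y"
        by (auto simp: pm_def)
      then show "z \<in> (+) y ` lat \<union> (\<lambda>z. z - y) ` lat"
        by blast
    qed
    then show ?thesis
      by (rule countable_subset) (simp add: countable_lat)
  qed
  then have con: "connected (- pm y)"
    using connected_open_diff_countable[of UNIV "pm y"] connected_UNIV[where 'a = complex]
    by (simp add: Compl_eq_Diff_UNIV)
  have hol: "ell y holomorphic_on - pm y"
    using ell_analytic analytic_on_analytic_at analytic_imp_holomorphic by blast
  obtain S where S: "open S" "p \<in> S" "\<And>z. z \<in> S \<Longrightarrow> z \<noteq> p \<Longrightarrow> ell y z = c"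
    using assms(3) unfolding eventually_at_filter eventually_nhds by blast
  have "ell y z = c" if "z \<in> - pm y" for z
  proof (rule analytic_continuation_open[of "S \<inter> - pm y - {p}" "- pm y" "ell y" "\<lambda>_. c" z])
    show "S \<inter> - pm y - {p} \<noteq> {}"
    proof
      assume "S \<inter> - pm y - {p} = {}"
      then have "S \<inter> - pm y = {p}"
        using S(2) assms(2) by blast
      moreover have "open (S \<inter> - pm y)"
        using S(1) op by blast
      ultimately show False
        using not_open_singleton[of p] by metis
    qed
    show "open (S \<inter> - pm y - {p})"
      using S(1) op by (intro open_delete open_Int)
  qed (use S op con hol that in auto)
  then have "\<forall>\<^sub>F z in at y. ell y z = c"
    using eventually_notin_pm[of y y] by (auto elim: eventually_mono)
  moreover have "\<forall>\<^sub>F z in at y. ell y z \<noteq> c"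
    using assms(1) by (intro ell_neq_near_pole) auto
  ultimately have "\<forall>\<^sub>F z in at y. False"
    by eventually_elim simp
  then show False by simp
qed

lemma ellprod_const:
  assumes "b \<notin> half_lat" "y \<notin> half_lat" "y \<notin> pm b"
  obtains K where "K \<noteq> 0" "\<And>z. z \<notin> pm b \<Longrightarrow> z \<notin> pm y \<Longrightarrow> ellprod b y z = K"
proof -
  \<comment> \<open>Limits instead of values: they ignore what \<open>1 / 0 = 0\<close> does at the
    isolated singularities.\<close>
  define Q where "Q z = Lim (at z) (ellprod b y)" for z
  have loc: "\<exists>q. q analytic_on {p} \<and> (\<forall>\<^sub>F w in nhds p. Q w = q w \<and> (ellprod b y \<longlongrightarrow> q w) (at w))" for p
  proof -
    obtain q where q: "q analytic_on {p}" "\<forall>\<^sub>F z in at p. ellprod b y z = q z"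
      using ellprod_local[OF assms] by blast
    have "\<forall>\<^sub>F w in nhds p. (ellprod b y \<longlongrightarrow> q w) (at w)"
      by (rule eventually_at_extend_analytic[OF q])
    then have "\<forall>\<^sub>F w in nhds p. Q w = q w \<and> (ellprod b y \<longlongrightarrow> q w) (at w)"
      by eventually_elim (auto simp: Q_def intro!: tendsto_Lim)
    then show ?thesis using q by blast
  qed
  have lim: "(ellprod b y \<longlongrightarrow> Q z) (at z)" for z
  proof -
    obtain q where "\<forall>\<^sub>F w in nhds z. Q w = q w \<and> (ellprod b y \<longlongrightarrow> q w) (at w)"
      using loc by blast
    then have "Q z = q z \<and> (ellprod b y \<longlongrightarrow> q z) (at z)"
      by (rule eventually_nhds_x_imp_x)
    then show ?thesis by simp
  qed
  have "Q analytic_on {p}" for p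
  proof -
    obtain q where q: "q analytic_on {p}" "\<forall>\<^sub>F w in nhds p. Q w = q w \<and> (ellprod b y \<longlongrightarrow> q w) (at w)"
      using loc by blast
    have "\<forall>\<^sub>F w in nhds p. q w = Q w"
      using q(2) by eventually_elim simp
    then show ?thesis
      using q(1) analytic_at_cong by blast
  qed
  then have hol: "Q holomorphic_on UNIV"
    using analytic_on_analytic_at analytic_imp_holomorphic by blast
  have per: "Q (z + l) = Q z" if l: "l \<in> lat" for z l
  proof -
    have "((\<lambda>x. ellprod b y (x + l)) \<longlongrightarrow> Q (z + l)) (at (z + l - l))"
      by (rule LIM_offset[OF lim])
    then have "(ellprod b y \<longlongrightarrow> Q (z + l)) (at z)"
      by (simp add: ellprod_def[abs_def] ell_periodic[OF l])
    then show ?thesis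
      using lim by (rule tendsto_unique[OF at_neq_bot])
  qed
  have "range Q \<subseteq> Q ` cbox 0 (1 + \<i>)"
  proof clarify
    fix z
    obtain l where l: "l \<in> lat" "z - l \<in> cbox 0 (1 + \<i>)"
      by (rule reduce_mod_lat)
    then have "Q z = Q (z - l)"
      using per[of l "z - l"] by simp
    then show "Q z \<in> Q ` cbox 0 (1 + \<i>)"
      using l(2) by blast
  qed
  moreover have "bounded (Q ` cbox 0 (1 + \<i>))"
    by (intro compact_imp_bounded compact_continuous_image continuous_on_subset[OF holomorphic_on_imp_continuous_on[OF hol]])
       auto
  ultimately have "bounded (range Q)"
    using bounded_subset by blast
  then obtain K where K: "\<And>z. Q z = K"
    using Liouville_theorem[OF hol] unfolding constant_on_def by blast
  have eq: "ellprod b y z = K" if "z \<notin> pm b" "z \<notin> pm y" for z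
  proof -
    have "ellprod b y analytic_on {z}"
      unfolding ellprod_def using that by (intro analytic_intros ell_analytic)
    then have "(ellprod b y \<longlongrightarrow> ellprod b y z) (at z)"
      using analytic_at_imp_isCont isCont_def by blast
    then show ?thesis
      using lim[of z] unfolding K by (rule tendsto_unique[OF at_neq_bot])
  qed
  \<comment> \<open>Near its pole \<open>b\<close> the first factor has no zeros, so
    \<open>K = 0\<close> would make the second factor vanish on a punctured neighbourhood of
    \<open>b\<close>.\<close>
  have "K \<noteq> 0"
  proof
    assume "K = 0"
    have "\<forall>\<^sub>F z in at b. ell b z \<noteq> ell b y"
      using assms by (intro ell_neq_near_pole) auto
    then have "\<forall>\<^sub>F z in at b. ell y z = ell y b"
      using eventually_notin_pm[of b b] eventually_notin_pm[of y b]
      by eventually_elim (use eq \<open>K = 0\<close> in \<open>auto simp: ellprod_def\<close>)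
    then show False
      using ell_not_locally_constant assms pm_sym by blast
  qed
  then show ?thesis using that eq by blast
qed

text \<open>At \<open>z = x\<close> the first factor of \<open>ellprod b y\<close> is 0, but away
  from both sets of poles the product is a nonzero constant.\<close>

lemma ell_fibre:
  assumes "b \<notin> half_lat" "y \<notin> half_lat" "y \<notin> pm b" "x \<notin> pm b" "ell b x = ell b y"
  shows "x \<in> pm y"
proof (rule ccontr)
  assume "x \<notin> pm y"
  then show False
    using ellprod_const[OF assms(1-3)] assms(4,5) unfolding ellprod_def
    by (metis cancel_comm_monoid_add_class.diff_cancel mult_zero_left)
qed

text \<open>Multiplying the constant product by \<open>D\<close> removes the pole of
  \<open>ell y\<close> at \<open>y\<close>. If the derivative of \<open>ell b\<close> vanished
  there, the left side would vanish to second order, while \<open>K * D z\<close> has a simple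
  zero.\<close>

lemma deriv_ell_nonzero:
  assumes "b \<notin> half_lat" "y \<notin> half_lat" "y \<notin> pm b"
  shows "deriv (ell b) y \<noteq> 0"
proof
  assume zero: "deriv (ell b) y = 0"
  obtain K where K: "K \<noteq> 0" "\<And>z. z \<notin> pm b \<Longrightarrow> z \<notin> pm y \<Longrightarrow> ellprod b y z = K"
    using ellprod_const[OF assms] by metis
  obtain D B where D: "D analytic_on {y}" "B analytic_on {y}" "D y = 0" "deriv D y \<noteq> 0"
    and eq: "\<And>z. ell y z = 1 / D z + B z"
    using ell_pole[OF pm_refl(1) assms(2)] by blast
  have nz: "\<forall>\<^sub>F z in at y. D z \<noteq> 0"
    by (rule eventually_simple_zero_neq_0[OF D(1,3,4)])
  have "\<forall>\<^sub>F z in at y. (ell b z - ell b y) * (1 + D z * (B z - ell y b)) = K * D z"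
    using nz eventually_notin_pm[of b y] eventually_notin_pm[of y y]
  proof eventually_elim
    case (elim z)
    then have "K = (ell b z - ell b y) * (1 / D z + B z - ell y b)"
      using K(2)[of z] by (simp add: ellprod_def eq)
    then show ?case
      using elim(1) by (simp add: field_simps)
  qed
  then have ev: "\<forall>\<^sub>F z in nhds y. (ell b z - ell b y) * (1 + D z * (B z - ell y b)) = K * D z"
    using D(3) by (simp add: eventually_nhds_conv_at)
  have der: "(ell b has_field_derivative 0) (at y)"
    using analytic_on_imp_differentiable_at[OF ell_analytic[OF assms(3)]] zero DERIV_deriv_iff_field_differentiable by force
  have D': "(D has_field_derivative deriv D y) (at y)" "(B has_field_derivative deriv B y) (at y)"
    using D(1,2) analytic_on_imp_differentiable_at DERIV_deriv_iff_field_differentiable by blast+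
  have 1: "((\<lambda>z. (ell b z - ell b y) * (1 + D z * (B z - ell y b))) has_field_derivative 0) (at y)"
    by (rule derivative_eq_intros der D' refl)+ simp
  have 2: "((\<lambda>z. K * D z) has_field_derivative K * deriv D y) (at y)"
    by (rule derivative_eq_intros D' refl)+ simp
  have "((\<lambda>z. K * D z) has_field_derivative 0) (at y)"
    using 1 DERIV_cong_ev[OF refl ev refl] by blast
  then show False
    using 2 DERIV_unique K(1) D(4) by fastforce
qed

section \<open>The square torus\<close>

text \<open>The usual embedding of the torus as a product of two unit circles; \<open>Some\<close>
  merely adapts it to the type of points.\<close>

definition pr :: "complex \<Rightarrow> cp1 \<times> cp1" where
  "pr z = (Some (cis (2 * pi * Re z)), Some (cis (2 * pi * Im z)))"

lemma cis_2pi_eq_iff: "cis (2 * pi * s) = cis (2 * pi * t) \<longleftrightarrow> s - t \<in> \<int>"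
proof -
  have "cis (2 * pi * s) = cis (2 * pi * t) \<longleftrightarrow> (\<exists>n. 2 * pi * s = 2 * pi * t + 2 * pi * real_of_int n)"
    unfolding complex_eq_iff using sin_cos_eq_iff[of "2 * pi * s" "2 * pi * t"] by auto
  also have "\<dots> \<longleftrightarrow> (\<exists>n. s - t = real_of_int n)"
  proof -
    have "2 * pi * s = 2 * pi * t + 2 * pi * real_of_int n \<longleftrightarrow> s - t = real_of_int n" for n
    proof -
      have "2 * pi * s = 2 * pi * t + 2 * pi * real_of_int n \<longleftrightarrow> 2 * pi * s = 2 * pi * (t + real_of_int n)"
        by (simp only: distrib_left)
      then show ?thesis
        by (simp only: mult_cancel_left) auto
    qed
    then show ?thesis by simp
  qed
  finally show ?thesis
    by (auto simp: Ints_def)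
qed

lemma pr_eq_iff: "pr z = pr w \<longleftrightarrow> z - w \<in> lat"
  by (simp add: pr_def cis_2pi_eq_iff lat_def)

lemma pr_add_lat: "l \<in> lat \<Longrightarrow> pr (z + l) = pr z"
  by (simp add: pr_eq_iff)

lemma pm_iff_pr: "w \<in> pm z \<longleftrightarrow> pr w = pr z \<or> pr w = pr (- z)"
  by (simp add: pm_def pr_eq_iff)

text \<open>The quotient topology makes continuity of maps out of the torus a question about the
  plane; the embedding by circles then serves for separation and for lifting maps into the
  torus.\<close>

definition torus_top :: "(cp1 \<times> cp1) topology" where
  "torus_top = topology (\<lambda>U. U \<subseteq> range pr \<and> open (pr -` U))"

lemma openin_torus_top: "openin torus_top U \<longleftrightarrow> U \<subseteq> range pr \<and> open (pr -` U)"
proof -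
  have "istopology (\<lambda>U. U \<subseteq> range pr \<and> open (pr -` U))"
    unfolding istopology_def by (auto simp: vimage_Union intro!: open_Int)
  then show ?thesis
    by (simp add: torus_top_def)
qed

lemma topspace_torus_top [simp]: "topspace torus_top = range pr"
proof
  show "topspace torus_top \<subseteq> range pr"
    using openin_torus_top openin_topspace by blast
  have "pr -` range pr = UNIV" by auto
  then have "openin torus_top (range pr)"
    by (simp add: openin_torus_top)
  then show "range pr \<subseteq> topspace torus_top"
    by (rule openin_subset)
qed

lemma quotient_map_pr: "quotient_map euclidean torus_top pr"
  by (auto simp: quotient_map_def openin_torus_top vimage_def)

lemma continuous_map_pr: "continuous_map euclidean torus_top pr"
  using quotient_imp_continuous_map quotient_map_pr by blast

lemma openin_pr_image:
  assumes "open S" shows "openin torus_top (pr ` S)"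
proof -
  have "pr -` pr ` S = (\<Union>l\<in>lat. (+) l ` S)"
  proof (intro equalityI subsetI)
    fix z assume "z \<in> pr -` pr ` S"
    then obtain w where "w \<in> S" "pr z = pr w" by blast
    then show "z \<in> (\<Union>l\<in>lat. (+) l ` S)"
      by (intro UN_I[of "z - w"]) (auto simp: pr_eq_iff image_iff intro!: bexI[of _ w])
  next
    fix z assume "z \<in> (\<Union>l\<in>lat. (+) l ` S)"
    then obtain l w where "l \<in> lat" "w \<in> S" "z = l + w" by blast
    then show "z \<in> pr -` pr ` S"
      using pr_add_lat[of l w] by (auto simp: add.commute)
  qed
  then show ?thesis
    using assms by (auto simp: openin_torus_top open_translation)
qed

lemma continuous_map_torus_iff:
  "continuous_map torus_top X f \<longleftrightarrow> continuous_map euclidean X (f \<circ> pr)"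
  by (rule continuous_compose_quotient_map_eq[OF quotient_map_pr, symmetric])

definition the2 :: "cp1 \<times> cp1 \<Rightarrow> complex \<times> complex" where
  "the2 p = (the (fst p), the (snd p))"

lemma the2_pr: "the2 (pr z) = (cis (2 * pi * Re z), cis (2 * pi * Im z))"
  by (simp add: the2_def pr_def)

lemma continuous_map_the2: "continuous_map torus_top euclidean the2"
  unfolding continuous_map_torus_iff o_def the2_pr by (auto intro!: continuous_intros)

lemma inj_on_the2: "inj_on the2 (range pr)"
  by (auto simp: inj_on_def the2_def pr_def)

lemma Hausdorff_torus: "Hausdorff_space torus_top"
  by (rule Hausdorff_space_injective_preimage[OF Hausdorff_space_euclidean continuous_map_the2])
     (simp add: inj_on_the2)

lemma compact_torus: "compact_space torus_top"
proof -
  have "range pr = pr ` cbox 0 (1 + \<i>)"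
  proof (intro equalityI subsetI)
    fix p assume "p \<in> range pr"
    then obtain z where z: "p = pr z" by blast
    obtain l where "l \<in> lat" "z - l \<in> cbox 0 (1 + \<i>)"
      by (rule reduce_mod_lat)
    then show "p \<in> pr ` cbox 0 (1 + \<i>)"
      using z pr_add_lat[of l "z - l"] by auto
  qed auto
  moreover have "compactin torus_top (pr ` cbox 0 (1 + \<i>))"
    by (rule image_compactin[OF _ continuous_map_pr]) simp
  ultimately show ?thesis
    by (simp add: compact_space_def)
qed

lemma connected_torus: "connected_space torus_top"
proof -
  have "connectedin torus_top (pr ` UNIV)"
    by (rule connectedin_continuous_map_image[OF continuous_map_pr])
       (simp add: connected_UNIV)
  then show ?thesis
    by (metis connectedin_topspace topspace_torus_top)
qed

lemma homeomorphic_map_pr: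
  assumes "open S" "inj_on pr S"
  shows "homeomorphic_map (top_of_set S) (subtopology torus_top (pr ` S)) pr"
proof (rule bijective_open_imp_homeomorphic_map)
  show "continuous_map (top_of_set S) (subtopology torus_top (pr ` S)) pr"
    using continuous_map_from_subtopology[OF continuous_map_pr] 
    by (simp add: continuous_map_in_subtopology image_subset_iff_funcset)
  show "open_map (top_of_set S) (subtopology torus_top (pr ` S)) pr"
  proof (unfold open_map_def, intro allI impI)
    fix U assume "openin (top_of_set S) U"
    then have "open U" "U \<subseteq> S"
      using assms(1) by (auto simp: openin_open_eq)
    then show "openin (subtopology torus_top (pr ` S)) (pr ` U)"
      using openin_pr_image by (intro openin_subset_topspace_eq[THEN iffD2] openin_open_subtopology[THEN iffD2] conjI assms openin_pr_image) auto
  qed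
qed (use assms in \<open>auto simp: image_iff\<close>)

lemma inj_on_pr_ball: "r \<le> 1/2 \<Longrightarrow> inj_on pr (ball a r)"
proof (rule inj_onI)
  fix x y assume r: "r \<le> 1/2" and xy: "x \<in> ball a r" "y \<in> ball a r" and eq: "pr x = pr y"
  have "dist x y < 1"
    using xy r dist_triangle2[of x y a] by (simp add: dist_commute)
  then show "x = y"
    using eq lat_norm_less_1[of "x - y"] by (simp add: pr_eq_iff dist_norm)
qed

section \<open>Charts of the torus\<close>

text \<open>For injectivity of \<open>pr\<close> radius 1/2 would be enough. With 1/4, the lattice
  vectors by which two charts differ at two points of their overlap are less than four radii, that
  is 1, apart and hence equal: every transition map is a translation.\<close>

definition tdom :: "complex \<Rightarrow> (cp1 \<times> cp1) set" where
  "tdom a = pr ` ball a (1/4)"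

definition tcoord :: "complex \<Rightarrow> cp1 \<times> cp1 \<Rightarrow> complex" where
  "tcoord a = inv_into (ball a (1/4)) pr"

definition torus :: "(cp1 \<times> cp1) rsurface" where
  "torus = \<lparr>surf_top = torus_top, surf_charts = range (\<lambda>a. (tdom a, tcoord a))\<rparr>"

lemma surf_top_torus [simp]: "surf_top torus = torus_top"
  and surf_charts_torus: "surf_charts torus = range (\<lambda>a. (tdom a, tcoord a))"
  by (simp_all add: torus_def)

lemma tcoord_pr [simp]: "z \<in> ball a (1/4) \<Longrightarrow> tcoord a (pr z) = z"
  unfolding tcoord_def by (rule inv_into_f_f) (auto intro: inj_on_pr_ball)

lemma pr_in_tdom: "z \<in> ball a (1/4) \<Longrightarrow> pr z \<in> tdom a"
  unfolding tdom_def by blast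

lemma tcoord_image_tdom: "tcoord a ` tdom a = ball a (1/4)"
  unfolding tdom_def image_image by simp

lemma inv_tcoord [simp]:
  assumes "z \<in> ball a (1/4)" shows "inv_into (tdom a) (tcoord a) z = pr z"
proof -
  have "inj_on (tcoord a) (tdom a)"
  proof (rule inj_onI)
    fix p q assume pq: "p \<in> tdom a" "q \<in> tdom a" "tcoord a p = tcoord a q"
    obtain x y where "x \<in> ball a (1/4)" "p = pr x" "y \<in> ball a (1/4)" "q = pr y"
      using pq unfolding tdom_def by blast
    then show "p = q"
      using pq(3) by simp
  qed
  then have "inv_into (tdom a) (tcoord a) (tcoord a (pr z)) = pr z"
    using pr_in_tdom[OF assms] by (rule inv_into_f_f)
  then show ?thesis using assms by simp
qed

lemma tcoord_image: "tcoord a ` (tdom a \<inter> V) = {z \<in> ball a (1/4). pr z \<in> V}"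
proof (intro equalityI subsetI)
  fix z assume "z \<in> tcoord a ` (tdom a \<inter> V)"
  then show "z \<in> {z \<in> ball a (1/4). pr z \<in> V}"
    unfolding tdom_def by auto
next
  fix z assume "z \<in> {z \<in> ball a (1/4). pr z \<in> V}"
  then show "z \<in> tcoord a ` (tdom a \<inter> V)"
    using pr_in_tdom[of z a] by (intro image_eqI[of _ _ "pr z"]) auto
qed

lemma complex_chart_torus: "complex_chart torus_top (tdom a) (tcoord a)"
  unfolding complex_chart_def tcoord_image_tdom
proof (intro conjI)
  show "openin torus_top (tdom a)"
    unfolding tdom_def by (rule openin_pr_image) simp
  have hom: "homeomorphic_map (top_of_set (ball a (1/4))) (subtopology torus_top (tdom a)) pr"
    unfolding tdom_def by (intro homeomorphic_map_pr inj_on_pr_ball) auto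
  then obtain g where g: "homeomorphic_maps (top_of_set (ball a (1/4))) (subtopology torus_top (tdom a)) pr g"
    using homeomorphic_map_maps by blast
  then have "homeomorphic_map (subtopology torus_top (tdom a)) (top_of_set (ball a (1/4))) g"
    using homeomorphic_maps_map by blast
  moreover have "g p = tcoord a p" if p: "p \<in> topspace (subtopology torus_top (tdom a))" for p
  proof -
    obtain z where "z \<in> ball a (1/4)" "p = pr z"
      using p unfolding tdom_def by auto
    then show ?thesis
      using g by (simp add: homeomorphic_maps_def)
  qed
  ultimately show "homeomorphic_map (subtopology torus_top (tdom a)) (top_of_set (ball a (1/4))) (tcoord a)"
    by (rule homeomorphic_map_eq)
qed simp

lemma compact_riemann_surface_torus: "compact_riemann_surface torus"
  unfolding compact_riemann_surface_def surf_top_torus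
proof (intro conjI)
  show "\<forall>(U, f)\<in>surf_charts torus. complex_chart torus_top U f"
    by (auto simp: surf_charts_torus complex_chart_torus)
  have "p \<in> (\<Union>a. tdom a)" if p: "p \<in> range pr" for p
  proof -
    obtain z where "p = pr z" using p by blast
    then have "p \<in> tdom z" by (auto intro: pr_in_tdom)
    then show ?thesis by blast
  qed
  moreover have "tdom a \<subseteq> range pr" for a
    by (auto simp: tdom_def)
  moreover have "(\<Union>(U, f)\<in>surf_charts torus. U) = (\<Union>a. tdom a)"
    by (simp add: surf_charts_torus)
  ultimately show "(\<Union>(U, f)\<in>surf_charts torus. U) = topspace torus_top"
    unfolding topspace_torus_top by blast
  have "(tcoord c \<circ> inv_into (tdom a) (tcoord a)) holomorphic_on tcoord a ` (tdom a \<inter> tdom c)" for a c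
  proof (cases "tdom a \<inter> tdom c = {}")
    case False
    let ?S = "{z \<in> ball a (1/4). pr z \<in> tdom c}"
    let ?f = "tcoord c \<circ> inv_into (tdom a) (tcoord a)"
    have f: "?f z \<in> ball c (1/4)" "z - ?f z \<in> lat" if z: "z \<in> ?S" for z
    proof -
      obtain w where w: "w \<in> ball c (1/4)" "pr z = pr w"
        using z unfolding tdom_def by blast
      then have "?f z = w"
        using z by (auto simp: w(2))
      then show "?f z \<in> ball c (1/4)" "z - ?f z \<in> lat"
        using w by (auto simp: pr_eq_iff)
    qed
    obtain z0 where z0: "z0 \<in> ?S"
      using False tcoord_image[of a "tdom c"] by auto
    have "?f z = z - (z0 - ?f z0)" if z: "z \<in> ?S" for z
    proof -
      have "dist z a + dist (?f z) c + dist z0 a + dist (?f z0) c < 1"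
        using f(1)[OF z] f(1)[OF z0] z z0 by (simp add: dist_commute del: comp_apply)
      moreover have "cmod ((z - ?f z) - (z0 - ?f z0)) =
         cmod (((z - a) - (?f z - c)) - ((z0 - a) - (?f z0 - c)))"
        by (simp add: algebra_simps del: comp_apply)
      moreover have "\<dots> \<le> (dist z a + dist (?f z) c) + (dist z0 a + dist (?f z0) c)"
        unfolding dist_norm by (intro order_trans[OF norm_triangle_ineq4] add_mono order_refl norm_triangle_ineq4)
      ultimately have "cmod ((z - ?f z) - (z0 - ?f z0)) < 1"
        by linarith
      then have "(z - ?f z) - (z0 - ?f z0) = 0"
        by (intro lat_norm_less_1 lat_diff[OF f(2)[OF z] f(2)[OF z0]])
      then show ?thesis
        by (simp add: algebra_simps del: comp_apply)
    qed
    moreover have "(\<lambda>z. z - (z0 - ?f z0)) holomorphic_on ?S"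
      by (intro holomorphic_intros)
    ultimately show ?thesis
      unfolding tcoord_image using holomorphic_cong[OF refl, of ?S ?f "\<lambda>z. z - (z0 - ?f z0)"] by blast
  qed (simp add: holomorphic_on_def)
  then show "\<forall>(U, f)\<in>surf_charts torus. \<forall>(V, g)\<in>surf_charts torus.
      (g \<circ> inv_into U f) holomorphic_on f ` (U \<inter> V)"
    by (auto simp: surf_charts_torus simp del: o_apply)
qed (auto simp: compact_torus Hausdorff_torus connected_torus)

section \<open>The elliptic function as a map to the projective line\<close>

text \<open>The inverse of the chart \<open>inf_coord\<close> at infinity.\<close>

definition cp1_of_inv :: "complex \<Rightarrow> cp1" where
  "cp1_of_inv w = (if w = 0 then None else Some (1 / w))"

definition inf_coord :: "cp1 \<Rightarrow> complex" where
  "inf_coord p = (case p of None \<Rightarrow> 0 | Some z \<Rightarrow> 1 / z)"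

lemma surf_charts_CP1: "surf_charts CP1 = {(range Some, the), (- {Some 0}, inf_coord)}"
  by (simp add: CP1_def inf_coord_def[abs_def])

lemma surf_top_CP1: "surf_top CP1 = Alexandroff_compactification euclidean"
  by (simp add: CP1_def)

lemma topspace_CP1 [simp]: "topspace (surf_top CP1) = UNIV"
  by (auto simp: surf_top_CP1 image_iff)

lemma openin_CP1_imp_open_Some:
  assumes "openin (surf_top CP1) U" shows "open (Some -` U)"
  using openin_continuous_map_preimage[OF continuous_map_Some assms[unfolded surf_top_CP1]]
  by (simp add: vimage_def)

lemma openin_CP1_imp_open_inv:
  assumes "openin (surf_top CP1) U" shows "open (cp1_of_inv -` U)"
proof -
  have "open (Some -` U)"
    by (rule openin_CP1_imp_open_Some[OF assms])
  then have "open ((- {0}) \<inter> (\<lambda>w. 1 / w) -` (Some -` U))"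
    by (intro continuous_open_preimage) (auto intro!: continuous_intros)
  moreover have "(- {0}) \<inter> (\<lambda>w. 1 / w) -` (Some -` U) = {w. w \<noteq> 0 \<and> Some (1 / w) \<in> U}"
    by auto
  ultimately have 1: "open {w. w \<noteq> 0 \<and> Some (1 / w) \<in> U}"
    by simp
  show ?thesis
  proof (cases "None \<in> U")
    case False
    then have "cp1_of_inv -` U = {w. w \<noteq> 0 \<and> Some (1 / w) \<in> U}"
      by (auto simp: cp1_of_inv_def split: if_splits)
    then show ?thesis using 1 by simp
  next
    case True
    then obtain C where C: "compact C" "U = insert None (Some ` (- C))"
      using assms by (auto simp: surf_top_CP1 openin_Alexandroff_compactification Compl_eq_Diff_UNIV)
    then obtain M where M: "M > 0" "\<forall>x\<in>C. cmod x \<le> M"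
      using compact_imp_bounded bounded_pos by metis
    have "Some (1 / w) \<in> U" if w: "w \<in> ball 0 (1 / M)" "w \<noteq> 0" for w
    proof -
      have "cmod (1 / w) > M"
        using w M(1) by (simp add: norm_divide field_simps)
      then have "1 / w \<notin> C"
        using M(2) by auto
      then show ?thesis using C(2) by simp
    qed
    moreover have "0 \<in> ball (0::complex) (1 / M)"
      using M by simp
    ultimately have "cp1_of_inv -` U = {w. w \<noteq> 0 \<and> Some (1 / w) \<in> U} \<union> ball 0 (1 / M)"
      using True by (auto simp: cp1_of_inv_def split: if_splits)
    then show ?thesis using open_Un[OF 1 open_ball] by (simp only:)
  qed
qed

text \<open>A quarter period in both directions: doubled it is not a lattice point, so the poles at
  \<open>ebase\<close> and \<open>- ebase\<close> are distinct modulo the lattice and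
  simple.\<close>

definition ebase :: complex where "ebase = Complex (1/4) (1/4)"

lemma ebase_notin_half_lat: "ebase \<notin> half_lat"
proof
  assume "ebase \<in> half_lat"
  then have "(1/2 :: real) \<in> \<int>"
    by (simp add: half_lat_def lat_def ebase_def)
  then obtain k where "(1/2 :: real) = of_int k"
    by (auto simp: Ints_def)
  then have "real_of_int (2 * k) = real_of_int 1"
    by simp
  then have "2 * k = 1"
    by (simp only: of_int_eq_iff)
  then show False by presburger
qed

definition ephi :: "complex \<Rightarrow> cp1" where
  "ephi z = (if z \<in> pm ebase then None else Some (ell ebase z))"

definition tphi :: "cp1 \<times> cp1 \<Rightarrow> cp1" where
  "tphi p = ephi (inv_into UNIV pr p)"

lemma ephi_pm: "z \<in> pm w \<Longrightarrow> ephi z = ephi w"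
  using ell_pm[of z w] pm_trans pm_sym unfolding ephi_def by metis

lemma tphi_pr [simp]: "tphi (pr z) = ephi z"
proof -
  have "pr (inv_into UNIV pr (pr z)) = pr z"
    by (simp add: f_inv_into_f)
  then show ?thesis
    unfolding tphi_def by (intro ephi_pm) (simp add: pm_iff_pr)
qed

lemma ephi_fibre:
  assumes "z \<notin> half_lat" shows "ephi w = ephi z \<longleftrightarrow> w \<in> pm z"
proof
  assume eq: "ephi w = ephi z"
  show "w \<in> pm z"
  proof (cases "z \<in> pm ebase")
    case True
    then have "w \<in> pm ebase"
      using eq by (auto simp: ephi_def split: if_splits)
    then show ?thesis
      using True pm_sym pm_trans by blast
  next
    case False
    then have "w \<notin> pm ebase" "ell ebase w = ell ebase z"
      using eq by (auto simp: ephi_def split: if_splits)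
    then show ?thesis
      using ell_fibre[OF ebase_notin_half_lat assms False] by blast
  qed
qed (rule ephi_pm)

text \<open>In the coordinate at infinity the function is \<open>1 / (1 / D + B)\<close>; in the
  form \<open>D / (1 + D * B)\<close> it extends analytically over the pole and inherits the simple
  zero of \<open>D\<close>.\<close>

lemma ephi_near_pole:
  assumes "p \<in> pm ebase"
  obtains g where "g analytic_on {p}" "g p = 0" "deriv g p \<noteq> 0"
    "\<forall>\<^sub>F z in nhds p. ephi z = cp1_of_inv (g z)"
proof -
  obtain D B where D: "D analytic_on {p}" "B analytic_on {p}" "D p = 0" "deriv D p \<noteq> 0"
    and eq: "\<And>z. ell ebase z = 1 / D z + B z"
    using ell_pole[OF assms ebase_notin_half_lat] by metis
  define g where "g = (\<lambda>z. D z / (1 + D z * B z))"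
  have "(\<lambda>z. 1 + D z * B z) analytic_on {p}"
    by (intro analytic_intros D)
  then have "isCont (\<lambda>z. 1 + D z * B z) p"
    by (rule analytic_at_imp_isCont)
  then have nz: "\<forall>\<^sub>F z in at p. 1 + D z * B z \<noteq> 0"
    unfolding isCont_def by (rule tendsto_imp_eventually_ne) (simp add: D(3))
  have "\<forall>\<^sub>F z in at p. ephi z = cp1_of_inv (g z)"
    using nz eventually_simple_zero_neq_0[OF D(1,3,4)] eventually_notin_pm[of ebase p]
    by eventually_elim (simp add: ephi_def cp1_of_inv_def g_def eq field_simps)
  then have ev: "\<forall>\<^sub>F z in nhds p. ephi z = cp1_of_inv (g z)"
    using assms by (simp add: eventually_nhds_conv_at ephi_def cp1_of_inv_def g_def D(3))
  have an: "g analytic_on {p}"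
    unfolding g_def by (intro analytic_intros D) (simp add: D(3))
  have der: "(D has_field_derivative deriv D p) (at p)" "(B has_field_derivative deriv B p) (at p)"
    using D(1,2) analytic_on_imp_differentiable_at DERIV_deriv_iff_field_differentiable by blast+
  have "(g has_field_derivative deriv D p) (at p)"
    unfolding g_def using D(3) by (auto intro!: derivative_eq_intros der)
  then have "deriv g p \<noteq> 0"
    using DERIV_imp_deriv D(4) by metis
  then show ?thesis
    using that[OF an _ _ ev] by (simp add: g_def D(3))
qed

lemma eventually_ephi_Some:
  assumes "p \<notin> pm ebase" shows "\<forall>\<^sub>F z in nhds p. ephi z = Some (ell ebase z)"
proof -
  have "\<forall>\<^sub>F z in nhds p. z \<in> - pm ebase"
    using assms closed_pm by (intro eventually_nhds_in_open) auto
  then show ?thesis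
    by eventually_elim (simp add: ephi_def)
qed

lemma continuous_map_ephi: "continuous_map euclidean (surf_top CP1) ephi"
proof -
  have "open (ephi -` U)" if U: "openin (surf_top CP1) U" for U
  proof (subst open_subopen, intro ballI)
    fix p assume p: "p \<in> ephi -` U"
    \<comment> \<open>Locally \<open>ephi\<close> is an analytic function followed by an inverse
      chart; \<open>P\<close> stands for \<open>Some\<close> or \<open>cp1_of_inv\<close>.\<close>
    have ex: "\<exists>T. open T \<and> p \<in> T \<and> T \<subseteq> ephi -` U"
      if f: "f analytic_on {p}" and P: "open (P -` U)" and ev: "\<forall>\<^sub>F z in nhds p. ephi z = P (f z)"
      for f :: "complex \<Rightarrow> complex" and P
    proof -
      have "f p \<in> P -` U"
        using eventually_nhds_x_imp_x[OF ev] p by simp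
      then have "\<forall>\<^sub>F z in nhds p. f z \<in> P -` U"
        using analytic_at_imp_isCont[OF f] P unfolding isCont_def tendsto_at_iff_tendsto_nhds
        by (intro topological_tendstoD)
      then have "\<forall>\<^sub>F z in nhds p. z \<in> ephi -` U"
        using ev by eventually_elim simp
      then show ?thesis
        unfolding eventually_nhds by blast
    qed
    show "\<exists>T. open T \<and> p \<in> T \<and> T \<subseteq> ephi -` U"
    proof (cases "p \<in> pm ebase")
      case True
      then show ?thesis
        using ephi_near_pole ex openin_CP1_imp_open_inv[OF U] by metis
    next
      case False
      then show ?thesis
        using ex[OF ell_analytic openin_CP1_imp_open_Some[OF U] eventually_ephi_Some] by blast
    qed
  qed
  then show ?thesis
    by (simp add: continuous_map_def vimage_def)
qed

text \<open>The cases are a pole, a finite value in the affine chart and a nonzero finite value in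
  the chart at infinity; the last differs from the second by a nonzero factor in the
  derivative.\<close>

lemma ephi_chart:
  assumes "(V, k) \<in> surf_charts CP1" "ephi z \<in> V"
  shows "(k \<circ> ephi) analytic_on {z}" and "z \<notin> half_lat \<Longrightarrow> deriv (k \<circ> ephi) z \<noteq> 0"
proof -
  have "\<exists>f. f analytic_on {z} \<and> (\<forall>\<^sub>F w in nhds z. f w = (k \<circ> ephi) w) \<and> (z \<notin> half_lat \<longrightarrow> deriv f z \<noteq> 0)"
  proof (cases "z \<in> pm ebase")
    case True
    then have k: "k = inf_coord"
      using assms by (auto simp: surf_charts_CP1 ephi_def)
    obtain g where g: "g analytic_on {z}" "g z = 0" "deriv g z \<noteq> 0"
      "\<forall>\<^sub>F w in nhds z. ephi w = cp1_of_inv (g w)"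
      using ephi_near_pole[OF True] by metis
    have "\<forall>\<^sub>F w in nhds z. g w = (k \<circ> ephi) w"
      using g(4) by eventually_elim (simp add: k inf_coord_def cp1_of_inv_def)
    then show ?thesis using g by blast
  next
    case False
    have an: "ell ebase analytic_on {z}"
      by (rule ell_analytic[OF False])
    have nz: "z \<notin> half_lat \<longrightarrow> deriv (ell ebase) z \<noteq> 0"
      using deriv_ell_nonzero[OF ebase_notin_half_lat _ False] by blast
    consider "k = the" | "k = inf_coord" "ell ebase z \<noteq> 0"
      using assms False by (auto simp: surf_charts_CP1 ephi_def)
    then show ?thesis
    proof cases
      case 1
      have "\<forall>\<^sub>F w in nhds z. ell ebase w = (k \<circ> ephi) w"
        using eventually_ephi_Some[OF False] by eventually_elim (simp add: 1)
      then show ?thesis using an nz by blast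
    next
      case 2
      have "\<forall>\<^sub>F w in nhds z. 1 / ell ebase w = (k \<circ> ephi) w"
        using eventually_ephi_Some[OF False] by eventually_elim (simp add: 2(1) inf_coord_def)
      moreover have "(\<lambda>w. 1 / ell ebase w) analytic_on {z}"
        using 2(2) by (intro analytic_intros an) auto
      moreover have "((\<lambda>w. 1 / ell ebase w) has_field_derivative - deriv (ell ebase) z / (ell ebase z)\<^sup>2) (at z)"
      proof -
        have "(ell ebase has_field_derivative deriv (ell ebase) z) (at z)"
          using an analytic_on_imp_differentiable_at DERIV_deriv_iff_field_differentiable by blast
        then show ?thesis
          using 2(2) by (auto intro!: derivative_eq_intros simp: power2_eq_square)
      qed
      then have "z \<notin> half_lat \<longrightarrow> deriv (\<lambda>w. 1 / ell ebase w) z \<noteq> 0"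
        using DERIV_imp_deriv nz 2(2) by fastforce
      ultimately show ?thesis by blast
    qed
  qed
  then obtain f where f: "f analytic_on {z}" "\<forall>\<^sub>F w in nhds z. f w = (k \<circ> ephi) w"
    "z \<notin> half_lat \<longrightarrow> deriv f z \<noteq> 0" by blast
  show "(k \<circ> ephi) analytic_on {z}"
    using f(1) analytic_at_cong[OF f(2) refl] by blast
  show "deriv (k \<circ> ephi) z \<noteq> 0" if "z \<notin> half_lat"
    using f(3) that deriv_cong_ev[OF f(2) refl] by metis
qed

lemma holomorphic_map_tphi: "holomorphic_map torus CP1 tphi"
  unfolding holomorphic_map_def surf_top_torus
proof (intro conjI)
  have "tphi \<circ> pr = ephi" by auto
  then show "continuous_map torus_top (surf_top CP1) tphi"
    using continuous_map_ephi by (simp add: continuous_map_torus_iff)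
  have "(k \<circ> tphi \<circ> inv_into (tdom a) (tcoord a)) holomorphic_on tcoord a ` (tdom a \<inter> tphi -` V)"
    if Vk: "(V, k) \<in> surf_charts CP1" for a V k
  proof -
    let ?S = "{z \<in> ball a (1/4). pr z \<in> tphi -` V}"
    have "(k \<circ> ephi) analytic_on ?S"
      by (subst analytic_on_analytic_at) (use ephi_chart(1)[OF Vk] in simp)
    then have "(k \<circ> ephi) holomorphic_on ?S"
      by (rule analytic_imp_holomorphic)
    then show ?thesis
      unfolding tcoord_image by (rule holomorphic_transform) simp
  qed
  then show "\<forall>(U, f)\<in>surf_charts torus. \<forall>(V, g)\<in>surf_charts CP1.
      (g \<circ> tphi \<circ> inv_into U f) holomorphic_on f ` (U \<inter> tphi -` V)"
    by (auto simp: surf_charts_torus simp del: o_apply)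
qed

lemma zero_notin_pm_ebase: "0 \<notin> pm ebase"
proof
  assume "0 \<in> pm ebase"
  then have "0 \<in> half_lat \<longleftrightarrow> ebase \<in> half_lat"
    by (rule half_lat_pm)
  then show False
    using ebase_notin_half_lat by (simp add: half_lat_def)
qed

lemma nonconstant_meromorphic_tphi: "nonconstant_meromorphic torus tphi"
  unfolding nonconstant_meromorphic_def
proof (intro conjI notI)
  assume "\<exists>c. \<forall>p\<in>topspace (surf_top torus). tphi p = c"
  then have "tphi (pr ebase) = tphi (pr 0)"
    by (metis rangeI surf_top_torus topspace_torus_top)
  then show False
    using zero_notin_pm_ebase by (simp add: ephi_def)
qed (rule holomorphic_map_tphi)

text \<open>Evenness and periodicity make \<open>ell ebase\<close> symmetric under the point
  reflection at \<open>c\<close>, so its derivative there equals its own negative.\<close>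

lemma deriv_ell_half_lat:
  assumes "c \<in> half_lat" "c \<notin> pm ebase" shows "deriv (ell ebase) c = 0"
proof -
  have der: "(ell ebase has_field_derivative deriv (ell ebase) c) (at c)"
    using ell_analytic[OF assms(2)] analytic_on_imp_differentiable_at DERIV_deriv_iff_field_differentiable
    by blast
  have refl: "ell ebase (2 * c - z) = ell ebase z" for z
    using ell_pm[of "2 * c - z" z ebase] assms(1) by (simp add: pm_def half_lat_def)
  have "((\<lambda>z. ell ebase (2 * c - z)) has_field_derivative deriv (ell ebase) c * (- 1)) (at c)"
    by (rule DERIV_chain2[where f = "ell ebase" and g = "\<lambda>z. 2 * c - z"])
       (use der in \<open>auto intro!: derivative_eq_intros\<close>)
  then have "deriv (ell ebase) c = deriv (ell ebase) c * (- 1)"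
    unfolding refl using der DERIV_unique by blast
  then show ?thesis by simp
qed

lemma critical_points_tphi: "critical_points torus CP1 tphi = pr ` half_lat"
proof -
  have loc: "deriv (k \<circ> tphi \<circ> inv_into (tdom a) (tcoord a)) z = deriv (k \<circ> ephi) z"
    if z: "z \<in> ball a (1/4)" for k :: "cp1 \<Rightarrow> complex" and a z
  proof (rule deriv_cong_ev)
    show "\<forall>\<^sub>F x in nhds z. (k \<circ> tphi \<circ> inv_into (tdom a) (tcoord a)) x = (k \<circ> ephi) x"
      using eventually_nhds_in_open[OF open_ball z] by eventually_elim simp
  qed simp
  show ?thesis
  proof (intro equalityI subsetI)
    fix p assume "p \<in> critical_points torus CP1 tphi"
    then obtain U f V k where Uf: "(U, f) \<in> surf_charts torus"
      and Vk: "(V, k) \<in> surf_charts CP1" "p \<in> U" "tphi p \<in> V"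
      "deriv (k \<circ> tphi \<circ> inv_into U f) (f p) = 0"
      unfolding critical_points_def by blast
    obtain a where a: "U = tdom a" "f = tcoord a"
      using Uf by (auto simp: surf_charts_torus)
    note Vk = Vk[unfolded a]
    then obtain z where z: "z \<in> ball a (1/4)" "p = pr z"
      unfolding tdom_def by blast
    have "deriv (k \<circ> ephi) z = 0"
      using Vk(4) loc[OF z(1), of k] z by simp
    then have "z \<in> half_lat"
      using ephi_chart(2)[OF Vk(1)] Vk(3) z(2) by auto
    then show "p \<in> pr ` half_lat"
      using z(2) by blast
  next
    fix p assume "p \<in> pr ` half_lat"
    then obtain c where c: "c \<in> half_lat" "p = pr c" by blast
    have c': "c \<notin> pm ebase"
      using c(1) half_lat_pm ebase_notin_half_lat by blast
    have "deriv (the \<circ> ephi) c = deriv (ell ebase) c"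
    proof (rule deriv_cong_ev)
      show "\<forall>\<^sub>F x in nhds c. (the \<circ> ephi) x = ell ebase x"
        using eventually_ephi_Some[OF c'] by eventually_elim simp
    qed simp
    then have "deriv (the \<circ> tphi \<circ> inv_into (tdom c) (tcoord c)) (tcoord c p) = 0"
      using deriv_ell_half_lat[OF c(1) c'] loc[of c c the] c(2) by simp
    moreover have "p \<in> tdom c"
      using c(2) by (auto intro: pr_in_tdom)
    moreover have "tphi p \<in> range Some"
      using c(2) c' by (simp add: ephi_def)
    moreover have "(tdom c, tcoord c) \<in> surf_charts torus" "(range Some, the) \<in> surf_charts CP1"
      by (simp_all add: surf_charts_torus surf_charts_CP1)
    ultimately show "p \<in> critical_points torus CP1 tphi"
      unfolding critical_points_def surf_top_torus topspace_torus_top using c(2) by blast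
  qed
qed

section \<open>Graphs of straight loops\<close>

text \<open>Doubled, the coordinates are 1/3 and 2/3: neither of them nor their difference is an
  integer. Hence no line through \<open>zbase\<close> in one of the three directions contains a
  point of \<open>half_lat\<close> or meets a lattice translate of its own reflection.\<close>

definition zbase :: complex where "zbase = Complex (1/6) (1/3)"

definition line :: "complex \<Rightarrow> real \<Rightarrow> complex" where
  "line d t = zbase + of_real t * d"

text \<open>Any two of these vectors have determinant 1 or -1, so they form a basis of the lattice
  and the closed straight loops through a common point meet nowhere else.\<close>

definition dirs :: "complex set" where "dirs = {1, \<i>, 1 + \<i>}"

definition edge :: "complex \<Rightarrow> (cp1 \<times> cp1) set" where
  "edge d = (\<lambda>t. pr (line d t)) ` {0<..<1}"

definition line_graph :: "complex set \<Rightarrow> (cp1 \<times> cp1) egraph" where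
  "line_graph D = \<lparr>verts = {pr zbase}, edges = edge ` D\<rparr>"

lemma verts_line_graph [simp]: "verts (line_graph D) = {pr zbase}"
  and edges_line_graph [simp]: "edges (line_graph D) = edge ` D"
  by (simp_all add: line_graph_def)

lemma line_0 [simp]: "line d 0 = zbase"
  by (simp add: line_def)

lemma dirs_cases:
  assumes "d \<in> dirs" obtains "d = 1" | "d = \<i>" | "d = 1 + \<i>"
  using assms by (auto simp: dirs_def)

lemma Re_line: "Re (line d t) = 1/6 + t * Re d" and Im_line: "Im (line d t) = 1/3 + t * Im d"
  by (simp_all add: line_def zbase_def)

lemma pr_line_1 [simp]: "d \<in> dirs \<Longrightarrow> pr (line d 1) = pr zbase"
  by (auto simp: pr_eq_iff line_def dirs_def)

lemma continuous_on_line: "continuous_on A (line d)"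
  unfolding line_def by (intro continuous_intros)

lemma Ints_third: "x \<in> \<int> \<Longrightarrow> (x::real) \<noteq> 1/3" "x \<in> \<int> \<Longrightarrow> x \<noteq> 2/3"
  using Ints_nonzero_abs_less1[of x] by auto

text \<open>The parameter \<open>t\<close> may be an endpoint, so this covers simplicity of the
  loops, their disjointness and the separation of open edges from the vertex at once.\<close>

lemma pr_line_eq:
  assumes "d \<in> dirs" "d' \<in> dirs" "s \<in> {0<..<1}" "t \<in> {0..1}" "pr (line d s) = pr (line d' t)"
  shows "d = d' \<and> s = t"
proof -
  have s: "s \<notin> \<int>"
    using Ints_nonzero_abs_less1[of s] assms(3) by auto
  have t: "s - t \<in> \<int> \<Longrightarrow> s = t"
    using Ints_nonzero_abs_less1[of "s - t"] assms(3,4) by auto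
  have 1: "s * Re d - t * Re d' \<in> \<int>" "s * Im d - t * Im d' \<in> \<int>"
    using assms(5) by (simp_all add: pr_eq_iff lat_def Re_line Im_line)
  have s': "\<not> (s - t \<in> \<int> \<and> t \<in> \<int>)"
    using Ints_add[of "s - t" t] s by auto
  show ?thesis
    using 1 s t s' assms(1,2) by (elim dirs_cases) simp_all
qed

lemma line_notin_half_lat:
  assumes "d \<in> dirs" shows "line d t \<notin> half_lat"
proof
  assume "line d t \<in> half_lat"
  then have *: "1/3 + 2 * (t * Re d) \<in> \<int>" "2/3 + 2 * (t * Im d) \<in> \<int>"
    by (simp_all add: half_lat_def lat_def Re_line Im_line algebra_simps)
  then show False
    using assms Ints_diff[OF *(2,1)] Ints_third by (elim dirs_cases) auto
qed

lemma line_reflect: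
  assumes "d \<in> dirs" "d' \<in> dirs" "line d s + line d' t \<in> lat" shows "d \<noteq> d'"
proof
  assume "d = d'"
  then have *: "1/3 + (s + t) * Re d \<in> \<int>" "2/3 + (s + t) * Im d \<in> \<int>"
    using assms(3) by (simp_all add: lat_def Re_line Im_line algebra_simps)
  then show False
    using assms(1) Ints_diff[OF *(2,1)] Ints_third by (elim dirs_cases) auto
qed

lemma edge_inj: "inj_on edge dirs"
proof (rule inj_onI)
  fix d d' assume d: "d \<in> dirs" "d' \<in> dirs" "edge d = edge d'"
  have "pr (line d (1/2)) \<in> edge d"
    unfolding edge_def by auto
  then obtain t where "t \<in> {0<..<1}" "pr (line d (1/2)) = pr (line d' t)"
    unfolding d(3) unfolding edge_def by blast
  then show "d = d'"
    using pr_line_eq[of d d' "1/2" t] d by auto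
qed

lemma vertex_notin_edge: "d \<in> dirs \<Longrightarrow> pr zbase \<notin> edge d"
  using pr_line_eq[of d d _ 0] unfolding edge_def by force

lemma disjnt_edges: "d \<in> dirs \<Longrightarrow> d' \<in> dirs \<Longrightarrow> d \<noteq> d' \<Longrightarrow> edge d \<inter> edge d' = {}"
proof (rule equals0I)
  fix x assume d: "d \<in> dirs" "d' \<in> dirs" "d \<noteq> d'" and "x \<in> edge d \<inter> edge d'"
  then obtain s t where "s \<in> {0<..<1}" "t \<in> {0<..<1}" "pr (line d s) = pr (line d' t)"
    unfolding edge_def by blast
  then show False
    using pr_line_eq[of d d' s t] d by auto
qed

lemma closed_edge_eq:
  assumes "d \<in> dirs" shows "insert (pr zbase) (edge d) = (\<lambda>t. pr (line d t)) ` {0..1}"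
proof -
  have "{0..1::real} = insert 0 (insert 1 {0<..<1})"
    by auto
  then show ?thesis
    using assms by (simp add: edge_def)
qed

lemma graph_support_line_graph:
  assumes "D \<subseteq> dirs" "D \<noteq> {}"
  shows "graph_support (line_graph D) = (\<Union>d\<in>D. (\<lambda>t. pr (line d t)) ` {0..1})"
proof -
  have "graph_support (line_graph D) = (\<Union>d\<in>D. insert (pr zbase) (edge d))"
    using assms(2) by (auto simp: graph_support_def)
  also have "\<dots> = (\<Union>d\<in>D. (\<lambda>t. pr (line d t)) ` {0..1})"
    using assms(1) closed_edge_eq by (intro SUP_cong) auto
  finally show ?thesis .
qed

lemma continuous_map_pr_line: "continuous_map euclideanreal torus_top (\<lambda>t. pr (line d t))"
  using continuous_map_compose[OF _ continuous_map_pr, of euclideanreal "line d"]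
  by (simp add: o_def continuous_on_line)

lemma edge_param_line:
  assumes "d \<in> dirs" shows "edge_param torus_top {pr zbase} (edge d) (\<lambda>t. pr (line d t))"
  unfolding edge_param_def
proof (intro conjI)
  show "pathin torus_top (\<lambda>t. pr (line d t))"
    unfolding pathin_def using continuous_map_from_subtopology[OF continuous_map_pr_line] by simp
  show "inj_on (\<lambda>t. pr (line d t)) {0<..<1}"
    using pr_line_eq[OF assms assms] by (intro inj_onI) auto
  show "edge d \<inter> {pr zbase} = {}"
    using vertex_notin_edge[OF assms] by simp
qed (use assms in \<open>simp_all add: edge_def\<close>)

lemma edge_ends_edge:
  assumes "d \<in> dirs" shows "edge_ends torus_top (edge d) = {pr zbase}"
proof -
  have "torus_top closure_of edge d \<subseteq> (\<lambda>t. pr (line d t)) ` {0..1}"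
  proof (rule closure_of_minimal)
    show "closedin torus_top ((\<lambda>t. pr (line d t)) ` {0..1})"
      by (intro compactin_imp_closedin Hausdorff_torus image_compactin[OF _ continuous_map_pr_line]) simp
  qed (auto simp: edge_def)
  moreover have "(\<lambda>t. pr (line d t)) ` {0..1} \<subseteq> torus_top closure_of edge d"
    using continuous_map_image_closure_subset[OF continuous_map_pr_line, where S = "{0<..<1}"]
    by (simp add: edge_def)
  ultimately have "torus_top closure_of edge d = insert (pr zbase) (edge d)"
    using closed_edge_eq[OF assms] by simp
  then show ?thesis
    using vertex_notin_edge[OF assms] by (auto simp: edge_ends_def)
qed

lemma finite_dirs: "finite dirs"
  by (simp add: dirs_def)

lemma ribbon_graph_line_graph:
  assumes "D \<subseteq> dirs" "card D \<ge> 2"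
  shows "ribbon_graph torus_top (line_graph D)"
  unfolding ribbon_graph_def
proof (intro conjI)
  show "finite (edges (line_graph D))"
    using assms(1) finite_subset finite_dirs by auto
  show "pairwise disjnt (edges (line_graph D))"
    using assms(1) disjnt_edges unfolding pairwise_def disjnt_def by fastforce
  show "\<forall>e\<in>edges (line_graph D). \<exists>\<gamma>. edge_param torus_top (verts (line_graph D)) e \<gamma>"
    using assms(1) edge_param_line by auto
  have "card (edge ` D) = card D"
    using assms(1) edge_inj by (intro card_image) (rule inj_on_subset)
  moreover have "{e \<in> edge ` D. pr zbase \<in> edge_ends torus_top e} = edge ` D"
    "{e \<in> edge ` D. edge_ends torus_top e = {pr zbase}} = edge ` D"
    using assms(1) edge_ends_edge by auto
  ultimately have "valence torus_top (line_graph D) (pr zbase) = 2 * card D"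
    by (simp add: valence_def)
  then show "\<forall>v\<in>verts (line_graph D). valence torus_top (line_graph D) v \<noteq> 1 \<and> valence torus_top (line_graph D) v \<noteq> 2"
    using assms(2) by auto
qed simp_all

section \<open>Faces of the graphs\<close>

text \<open>An open convex set is the interior of its closure. The closure is a compact convex body,
  thus homeomorphic to the closed disk, and invariance of domain carries the interiors
  along.\<close>

lemma homeomorphic_open_convex_ball:
  fixes A :: "complex set"
  assumes "open A" "convex A" "bounded A" "A \<noteq> {}"
  shows "top_of_set A homeomorphic_space top_of_set (ball (0::complex) 1)"
proof -
  have int: "interior (closure A) = A"
    using convex_interior_closure[OF assms(2)] assms(1) by (simp add: interior_open)
  then have "closure A homeomorphic cball (0::complex) 1"
    using assms by (intro homeomorphic_convex_compact) (auto simp: compact_closure)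
  then have "interior (closure A) homeomorphic interior (cball (0::complex) 1)"
    by (rule homeomorphic_interiors_same_dimension) simp
  then show ?thesis
    by (simp add: int homeomorphic_space_iff_homeomorphic)
qed

text \<open>Faces are presented as plane convex regions embedded by \<open>pr\<close>. Being
  connected, open and finitely many, with disjoint images that fill the complement, they are clopen
  there and hence its components.\<close>

lemma spansI:
  assumes fin: "finite \<A>" and compl: "range pr - graph_support \<Gamma> = (\<Union>A\<in>\<A>. pr ` A)"
    and A: "\<And>A. A \<in> \<A> \<Longrightarrow> open A \<and> convex A \<and> bounded A \<and> A \<noteq> {} \<and> inj_on pr A"
    and disj: "\<And>A B. A \<in> \<A> \<Longrightarrow> B \<in> \<A> \<Longrightarrow> A \<noteq> B \<Longrightarrow> pr ` A \<inter> pr ` B = {}"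
  shows "spans torus_top \<Gamma>"
proof -
  define W where "W = subtopology torus_top (range pr - graph_support \<Gamma>)"
  have openW: "openin W (pr ` A)" if "A \<in> \<A>" for A
    unfolding W_def using A[OF that] that compl
    by (auto simp: openin_subtopology intro!: exI[of _ "pr ` A"] openin_pr_image)
  have topW: "topspace W = (\<Union>A\<in>\<A>. pr ` A)"
    unfolding W_def using compl by auto
  have conn: "connectedin W (pr ` A)" if "A \<in> \<A>" for A
  proof -
    have "connectedin torus_top (pr ` A)"
      by (rule connectedin_continuous_map_image[OF continuous_map_pr])
         (use A[OF that] in \<open>auto intro: convex_connected\<close>)
    then show ?thesis
      unfolding W_def using that compl by (auto simp: connectedin_subtopology)
  qed
  have comp: "\<exists>A\<in>\<A>. C = pr ` A" if C: "C \<in> connected_components_of W" for C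
  proof -
    have "C \<noteq> {}" "C \<subseteq> topspace W" "connectedin W C"
      using C nonempty_connected_components_of connected_components_of_subset 
        connectedin_connected_components_of by blast+
    then obtain x A where xA: "x \<in> C" "A \<in> \<A>" "x \<in> pr ` A"
      unfolding topW by blast
    have "closedin W (pr ` A)"
    proof -
      have "topspace W - pr ` A = (\<Union>B\<in>\<A>-{A}. pr ` B)"
        unfolding topW using disj xA(2) by auto
      then show ?thesis
        unfolding closedin_def using openW topW xA(2) by (auto intro!: openin_Union)
    qed
    moreover have nd: "\<not> disjnt C (pr ` A)"
      using xA by (meson disjnt_iff)
    ultimately have "C \<subseteq> pr ` A"
      using connectedin_clopen_cases[OF \<open>connectedin W C\<close> _ openW[OF xA(2)]] by blast
    moreover have "pr ` A \<subseteq> C"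
      using connected_components_of_maximal[OF C conn[OF xA(2)] nd] .
    ultimately show ?thesis using xA(2) by blast
  qed
  have "connected_components_of W \<subseteq> (`) pr ` \<A>"
    using comp by blast
  then have "finite (connected_components_of W)"
    using fin finite_subset by blast
  moreover have "subtopology torus_top C homeomorphic_space top_of_set (ball (0::complex) 1)"
    if C: "C \<in> connected_components_of W" for C
  proof -
    obtain A where A': "A \<in> \<A>" "C = pr ` A" using comp[OF C] by blast
    have "homeomorphic_map (top_of_set A) (subtopology torus_top (pr ` A)) pr"
      by (rule homeomorphic_map_pr) (use A[OF A'(1)] in auto)
    then have "subtopology torus_top C homeomorphic_space top_of_set A"
      using A'(2) homeomorphic_map_imp_homeomorphic_space homeomorphic_space_sym by metis
    moreover have "top_of_set A homeomorphic_space top_of_set (ball (0::complex) 1)"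
      using A[OF A'(1)] homeomorphic_open_convex_ball by blast
    ultimately show ?thesis
      by (rule homeomorphic_space_trans)
  qed
  ultimately show ?thesis
    unfolding spans_def Let_def topspace_torus_top W_def by blast
qed

text \<open>The axis loops unfold to the sides of the unit square with corner \<open>zbase\<close>,
  the third loop to its diagonal. The predicate selects the whole square or one of the two
  triangles.\<close>

definition cell :: "(real \<Rightarrow> real \<Rightarrow> bool) \<Rightarrow> complex set" where
  "cell P = {z. 0 < Re (z - zbase) \<and> Re (z - zbase) < 1 \<and> 0 < Im (z - zbase) \<and> Im (z - zbase) < 1
     \<and> P (Re (z - zbase)) (Im (z - zbase))}"

text \<open>Two predicates are allowed so that the same fact gives injectivity on one face and
  disjointness of two.\<close>

lemma pr_cell_eq:
  assumes "z \<in> cell P" "w \<in> cell Q" "pr z = pr w" shows "z = w"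
proof -
  have "Re z - Re w \<in> \<int>" "Im z - Im w \<in> \<int>"
    using assms(3) by (auto simp: pr_eq_iff lat_def)
  moreover have "\<bar>Re z - Re w\<bar> < 1" "\<bar>Im z - Im w\<bar> < 1"
    using assms(1,2) by (auto simp: cell_def abs_less_iff)
  ultimately have "Re z - Re w = 0" "Im z - Im w = 0"
    using Ints_nonzero_abs_less1 by blast+
  then show ?thesis
    by (simp add: complex_eq_iff)
qed

lemma pr_cell_line:
  assumes "z \<in> cell P" "d \<in> dirs" "pr z = pr (line d t)"
  shows "d = 1 + \<i> \<and> Re (z - zbase) = Im (z - zbase)"
proof -
  have *: "Re (z - zbase) - t * Re d \<in> \<int>" "Im (z - zbase) - t * Im d \<in> \<int>"
    using assms(3) by (simp_all add: pr_eq_iff lat_def Re_line Im_line zbase_def algebra_simps)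
  have "Re (z - zbase) \<notin> \<int>" "Im (z - zbase) \<notin> \<int>"
    using assms(1) Ints_nonzero_abs_less1[of "Re (z - zbase)"] Ints_nonzero_abs_less1[of "Im (z - zbase)"]
    unfolding cell_def by (auto simp del: minus_complex.simps)
  then have d: "d = 1 + \<i>"
    using * assms(2) by (elim dirs_cases) auto
  then have "Re (z - zbase) - Im (z - zbase) \<in> \<int>"
    using Ints_diff[OF *] by (simp add: d algebra_simps)
  then have "Re (z - zbase) - Im (z - zbase) = 0"
    using assms(1) unfolding cell_def by (intro Ints_nonzero_abs_less1) auto
  then show ?thesis using d by simp
qed

lemma reduce_to_cell:
  obtains w where "pr w = pr z" "0 \<le> Re (w - zbase)" "Re (w - zbase) < 1" "0 \<le> Im (w - zbase)" "Im (w - zbase) < 1"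
proof
  let ?l = "of_int \<lfloor>Re (z - zbase)\<rfloor> + \<i> * of_int \<lfloor>Im (z - zbase)\<rfloor>"
  have "- ?l \<in> lat" unfolding lat_minus_iff by (intro lat_add) simp_all
  then show "pr (z - ?l) = pr z"
    using pr_add_lat[of "- ?l" z] by (simp only: add_uminus_conv_diff simp_thms)
qed (simp_all; linarith)+

lemma cells_complement:
  assumes D: "{1, \<i>} \<subseteq> D" "D \<subseteq> dirs"
    and P: "\<And>x y. (\<exists>P\<in>\<P>. P x y) \<longleftrightarrow> (1 + \<i> \<in> D \<longrightarrow> x \<noteq> y)"
  shows "range pr - graph_support (line_graph D) = (\<Union>A\<in>cell ` \<P>. pr ` A)"
proof (intro equalityI subsetI)
  have supp: "graph_support (line_graph D) = (\<Union>d\<in>D. (\<lambda>t. pr (line d t)) ` {0..1})"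
    using D by (intro graph_support_line_graph) auto
  fix p assume p: "p \<in> range pr - graph_support (line_graph D)"
  then obtain z where "p = pr z" by blast
  then obtain w where w: "p = pr w" "0 \<le> Re (w - zbase)" "Re (w - zbase) < 1"
      "0 \<le> Im (w - zbase)" "Im (w - zbase) < 1"
    using reduce_to_cell by metis
  have nl: "w \<noteq> line d t" if "d \<in> D" "t \<in> {0..1}" for d t
    using p that unfolding w(1) supp by blast
  have "Re (w - zbase) \<noteq> 0"
    using nl[of \<i> "Im (w - zbase)"] D(1) w
    by (auto simp: complex_eq_iff Re_line Im_line zbase_def)
  moreover have "Im (w - zbase) \<noteq> 0"
    using nl[of 1 "Re (w - zbase)"] D(1) w
    by (auto simp: complex_eq_iff Re_line Im_line zbase_def)
  moreover have "Re (w - zbase) \<noteq> Im (w - zbase)" if "1 + \<i> \<in> D"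
    using nl[of "1 + \<i>" "Re (w - zbase)"] that w
    by (auto simp: complex_eq_iff Re_line Im_line zbase_def)
  then obtain P where "P \<in> \<P>" "P (Re (w - zbase)) (Im (w - zbase))"
    using P by blast
  ultimately have "P \<in> \<P>" "w \<in> cell P"
    using w unfolding cell_def by auto
  then show "p \<in> (\<Union>A\<in>cell ` \<P>. pr ` A)"
    using w(1) by blast
next
  have supp: "graph_support (line_graph D) = (\<Union>d\<in>D. (\<lambda>t. pr (line d t)) ` {0..1})"
    using D by (intro graph_support_line_graph) auto
  fix p assume "p \<in> (\<Union>A\<in>cell ` \<P>. pr ` A)"
  then obtain P w where w: "P \<in> \<P>" "w \<in> cell P" "p = pr w" by blast
  have "pr w \<noteq> pr (line d t)" if d: "d \<in> D" for d t
  proof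
    assume "pr w = pr (line d t)"
    then have "d = 1 + \<i>" "Re (w - zbase) = Im (w - zbase)"
      using pr_cell_line[OF w(2)] d D(2) by auto
    moreover have "P (Re (w - zbase)) (Im (w - zbase))"
      using w(2) by (simp add: cell_def)
    ultimately show False
      using P w(1) d by blast
  qed
  then show "p \<in> range pr - graph_support (line_graph D)"
    unfolding supp w(3) by blast
qed

lemma cell_basics:
  assumes "P = (\<lambda>x y. True) \<or> P = (\<lambda>x y. x < y) \<or> P = (\<lambda>x y. y < x)"
  shows "open (cell P) \<and> convex (cell P) \<and> bounded (cell P) \<and> cell P \<noteq> {} \<and> inj_on pr (cell P)"
proof (intro conjI)
  let ?Q = "{z. Re z > Re zbase} \<inter> {z. Re z < Re zbase + 1} \<inter>
    {z. Im z > Im zbase} \<inter> {z. Im z < Im zbase + 1}"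
  let ?c = "Re zbase - Im zbase"
  let ?L = "{z. inner (Complex 1 (-1)) z < ?c}" and ?G = "{z. inner (Complex 1 (-1)) z > ?c}"
  have Q: "open ?Q" "convex ?Q"
    by (intro open_Int convex_Int open_halfspace_Re_gt open_halfspace_Re_lt open_halfspace_Im_gt
      open_halfspace_Im_lt convex_halfspace_Re_gt convex_halfspace_Re_lt convex_halfspace_Im_gt convex_halfspace_Im_lt)+
  have "open (?Q \<inter> ?L)" "convex (?Q \<inter> ?L)" "open (?Q \<inter> ?G)" "convex (?Q \<inter> ?G)"
    by (rule open_Int convex_Int Q open_halfspace_lt open_halfspace_gt convex_halfspace_lt convex_halfspace_gt)+
  moreover have "cell (\<lambda>x y. True) = ?Q"
    by (auto simp: cell_def)
  moreover have "cell (\<lambda>x y. x < y) = ?Q \<inter> ?L" "cell (\<lambda>x y. y < x) = ?Q \<inter> ?G"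
    by (auto simp: cell_def inner_complex_def)
  ultimately show "open (cell P)" "convex (cell P)"
    using assms Q by metis+
  have "cell P \<subseteq> cbox zbase (zbase + (1 + \<i>))"
    by (auto simp: cell_def in_cbox_complex_iff)
  then show "bounded (cell P)"
    using bounded_cbox bounded_subset by blast
  have "zbase + Complex (1/4) (3/4) \<in> cell (\<lambda>x y. True)" "zbase + Complex (1/4) (3/4) \<in> cell (\<lambda>x y. x < y)"
    "zbase + Complex (3/4) (1/4) \<in> cell (\<lambda>x y. y < x)"
    by (simp_all add: cell_def)
  then show "cell P \<noteq> {}"
    using assms by blast
  show "inj_on pr (cell P)"
    by (intro inj_onI) (rule pr_cell_eq)
qed

lemma spans_line_graph:
  assumes "D = {1, \<i>} \<or> D = dirs" shows "spans torus_top (line_graph D)"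
proof -
  define \<P> :: "(real \<Rightarrow> real \<Rightarrow> bool) set" where
    "\<P> = (if 1 + \<i> \<in> D then {\<lambda>x y. x < y, \<lambda>x y. y < x} else {\<lambda>x y. True})"
  have P: "P = (\<lambda>x y. True) \<or> P = (\<lambda>x y. x < y) \<or> P = (\<lambda>x y. y < x)" if "P \<in> \<P>" for P
    using that by (auto simp: \<P>_def split: if_splits)
  have disj: "pr ` cell P \<inter> pr ` cell Q = {}" if "P \<in> \<P>" "Q \<in> \<P>" "cell P \<noteq> cell Q" for P Q
  proof -
    have "cell P \<inter> cell Q = {}"
      using that by (auto simp: \<P>_def cell_def split: if_splits)
    then show ?thesis
      using pr_cell_eq[of _ P _ Q] by blast
  qed
  show ?thesis
  proof (rule spansI[of "cell ` \<P>"])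
    show "finite (cell ` \<P>)"
      by (simp add: \<P>_def)
    show "range pr - graph_support (line_graph D) = (\<Union>A\<in>cell ` \<P>. pr ` A)"
      using assms by (intro cells_complement) (auto simp: dirs_def \<P>_def)
    show "open A \<and> convex A \<and> bounded A \<and> A \<noteq> {} \<and> inj_on pr A" if "A \<in> cell ` \<P>" for A
      using that P cell_basics by blast
    show "pr ` A \<inter> pr ` B = {}" if "A \<in> cell ` \<P>" "B \<in> cell ` \<P>" "A \<noteq> B" for A B
      using that disj by blast
  qed
qed

section \<open>Genericity of the straight graphs\<close>

lemma vector_derivative_ephi_line:
  assumes "(V, k) \<in> surf_charts CP1" "ephi (line d t) \<in> V"
  shows "vector_derivative (k \<circ> (\<lambda>t. ephi (line d t))) (at t) = d * deriv (k \<circ> ephi) (line d t)"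
proof -
  have "(line d has_vector_derivative d) (at t)"
    unfolding line_def by (auto intro!: derivative_eq_intros simp: scaleR_conv_of_real)
  then have "((k \<circ> ephi) \<circ> line d has_vector_derivative d * deriv (k \<circ> ephi) (line d t)) (at t)"
    by (rule field_vector_diff_chain_at) (rule analytic_derivI[OF ephi_chart(1)[OF assms]])
  then show ?thesis
    unfolding o_def by (rule vector_derivative_at)
qed

lemma immersed_open_curve_line:
  assumes "d \<in> dirs" shows "immersed_open_curve CP1 (\<lambda>t. ephi (line d t))"
proof -
  have d: "d \<noteq> 0"
    using assms by (auto simp: dirs_def complex_eq_iff)
  have "smooth_on {t \<in> {0<..<1}. ephi (line d t) \<in> V} (k \<circ> (\<lambda>t. ephi (line d t)))"
    if Vk: "(V, k) \<in> surf_charts CP1" for V k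
  proof -
    \<comment> \<open>The higher derivatives along an affine line: each differentiation contributes
      a factor \<open>d\<close>.\<close>
    define F where "F n t = d ^ n * (deriv ^^ n) (k \<circ> ephi) (line d t)" for n t
    have "(F n has_vector_derivative F (Suc n) t) (at t)" if "ephi (line d t) \<in> V" for n t
    proof -
      have "(line d has_vector_derivative d) (at t)"
        unfolding line_def by (auto intro!: derivative_eq_intros simp: scaleR_conv_of_real)
      moreover have "((deriv ^^ n) (k \<circ> ephi) has_field_derivative (deriv ^^ Suc n) (k \<circ> ephi) (line d t)) (at (line d t))"
        using analytic_derivI[OF analytic_higher_deriv[OF ephi_chart(1)[OF Vk that]]] by simp
      ultimately have "((deriv ^^ n) (k \<circ> ephi) \<circ> line d has_vector_derivative
          d * (deriv ^^ Suc n) (k \<circ> ephi) (line d t)) (at t)"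
        by (rule field_vector_diff_chain_at)
      then have "((\<lambda>t. d ^ n * ((deriv ^^ n) (k \<circ> ephi) \<circ> line d) t) has_vector_derivative
          d ^ n * (d * (deriv ^^ Suc n) (k \<circ> ephi) (line d t))) (at t)"
        by (rule has_vector_derivative_mult_right)
      then show ?thesis
        by (simp add: F_def[abs_def] mult_ac)
    qed
    then show ?thesis
      unfolding smooth_on_def by (intro exI[of _ F]) (simp add: F_def)
  qed
  moreover have "vector_derivative (k \<circ> (\<lambda>t. ephi (line d t))) (at t) \<noteq> 0"
    if "(V, k) \<in> surf_charts CP1" "ephi (line d t) \<in> V" for V k t
    using vector_derivative_ephi_line[OF that] ephi_chart(2)[OF that line_notin_half_lat[OF assms]] d by simp
  ultimately show ?thesis
    unfolding immersed_open_curve_def Let_def by blast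
qed

text \<open>The function is invariant under the point reflection that exchanges \<open>z\<close> and
  \<open>w\<close>, and this reflection has derivative -1.\<close>

lemma deriv_ephi_reflect:
  assumes "(V, k) \<in> surf_charts CP1" "ephi z \<in> V" "z + w \<in> lat"
  shows "deriv (k \<circ> ephi) w = - deriv (k \<circ> ephi) z"
proof -
  have refl: "ephi (z + w - u) = ephi u" for u
    using ephi_pm[of "z + w - u" u] assms(3) by (simp add: pm_def)
  have "ephi w = ephi z"
    using refl[of w] by simp
  then have an: "((k \<circ> ephi) has_field_derivative deriv (k \<circ> ephi) w) (at w)"
    using analytic_derivI[OF ephi_chart(1)[OF assms(1)]] assms(2) by simp
  have "(((k \<circ> ephi) \<circ> (\<lambda>u. z + w - u)) has_field_derivative deriv (k \<circ> ephi) w * (- 1)) (at z)"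
    by (rule DERIV_chain) (use an in \<open>auto intro!: derivative_eq_intros\<close>)
  moreover have "(k \<circ> ephi) \<circ> (\<lambda>u. z + w - u) = k \<circ> ephi"
    by (auto simp: refl)
  ultimately have "deriv (k \<circ> ephi) z = deriv (k \<circ> ephi) w * (- 1)"
    by (simp add: DERIV_imp_deriv)
  then show ?thesis by simp
qed

text \<open>In any chart the two tangent vectors are \<open>d * a\<close> and
  \<open>d' * (- a)\<close> with a common \<open>a \<noteq> 0\<close>, so their independence is that
  of \<open>d\<close> and \<open>d'\<close>; a loop cannot meet its own reflection, hence
  \<open>d \<noteq> d'\<close>.\<close>

lemma transverse_at_lines:
  assumes "d \<in> dirs" "d' \<in> dirs" "line d s + line d' t \<in> lat"
  shows "transverse_at CP1 (\<lambda>t. ephi (line d t)) s (\<lambda>t. ephi (line d' t)) t"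
proof -
  have eq: "ephi (line d s) = ephi (line d' t)"
    by (rule ephi_pm) (simp add: pm_def assms(3))
  have ind: "\<not> collinear {0, d * a, d' * (- a)}" if a: "a \<noteq> 0" for a :: complex
  proof
    have nz: "d \<noteq> 0" "d' \<noteq> 0" and dd: "d \<noteq> d'"
      using assms(1,2) line_reflect[OF assms] by (auto simp: dirs_def complex_eq_iff)
    assume "collinear {0, d * a, d' * (- a)}"
    then obtain c where "d' * (- a) = c *\<^sub>R (d * a)"
      using a nz by (auto simp: collinear_lemma)
    then have "(- d') * a = (of_real c * d) * a"
      by (simp add: scaleR_conv_of_real algebra_simps)
    then have "- d' = of_real c * d"
      using a by (simp only: mult_cancel_right) auto
    then show False
      using assms(1,2) dd by (elim dirs_cases) (auto simp: complex_eq_iff)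
  qed
  show ?thesis
    unfolding transverse_at_def
  proof (intro conjI eq, clarify)
    fix V k assume Vk: "(V, k) \<in> surf_charts CP1" "ephi (line d s) \<in> V"
      and col: "collinear {0, vector_derivative (k \<circ> (\<lambda>t. ephi (line d t))) (at s),
        vector_derivative (k \<circ> (\<lambda>t. ephi (line d' t))) (at t)}"
    have V': "ephi (line d' t) \<in> V" using eq Vk by simp
    show False
      using col ind[OF ephi_chart(2)[OF Vk line_notin_half_lat[OF assms(1)]]]
      unfolding vector_derivative_ephi_line[OF Vk] vector_derivative_ephi_line[OF Vk(1) V']
        deriv_ephi_reflect[OF Vk assms(3)] by blast
  qed
qed

lemma line_graph_coincidence:
  assumes D: "D \<subseteq> dirs" "D \<noteq> {}" and "x \<in> graph_support (line_graph D)"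
    "y \<in> graph_support (line_graph D)" "x \<noteq> y" "tphi x = tphi y"
  obtains d d' s t where "d \<in> D" "d' \<in> D" "s \<in> {0<..<1}" "t \<in> {0<..<1}"
    "x = pr (line d s)" "y = pr (line d' t)" "line d s + line d' t \<in> lat"
proof -
  obtain d d' s t where 1: "d \<in> D" "d' \<in> D" "s \<in> {0..1}" "t \<in> {0..1}"
    "x = pr (line d s)" "y = pr (line d' t)"
    using assms(3,4) unfolding graph_support_line_graph[OF D] by blast
  have dirs: "d \<in> dirs" "d' \<in> dirs" using 1 D by auto
  have pm: "line d s \<in> pm (line d' t)"
    using assms(6) ephi_fibre[OF line_notin_half_lat[OF dirs(2)]] 1 by simp
  then have 2: "line d s + line d' t \<in> lat"
    using assms(5) 1 by (auto simp: pm_def pr_eq_iff)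
  \<comment> \<open>The vertex lies on every loop, in particular on that of direction
    \<open>e'\<close>. A coincidence there would make this loop meet its own reflection.\<close>
  have vertex: "r \<in> {0<..<1}"
    if r: "r \<in> {0..1}" and e: "e \<in> dirs" "e' \<in> dirs" "line e r + line e' r' \<in> lat" for r r' e e'
  proof (rule ccontr)
    assume "r \<notin> {0<..<1}"
    then have "r = 0 \<or> r = 1" using r by auto
    then have "pr (line e r) = pr zbase" using e by auto
    then have "zbase - line e r \<in> lat"
      using pr_eq_iff by metis
    then have "line e' 0 + line e' r' \<in> lat"
      using lat_add[OF _ e(3), of "zbase - line e r"] by simp
    then show False
      using line_reflect[OF e(2) e(2)] by blast
  qed
  show ?thesis
  proof (rule that[OF 1(1,2) _ _ 1(5,6) 2])
    show "s \<in> {0<..<1}" using vertex[OF 1(3) dirs 2] .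
    show "t \<in> {0<..<1}" using vertex[OF 1(4) dirs(2,1)] 2 by (simp add: add.commute)
  qed
qed

lemma generic_line_graph:
  assumes D: "D \<subseteq> dirs" "D \<noteq> {}"
  shows "generic torus tphi (line_graph D)"
proof -
  let ?\<gamma> = "\<lambda>e t. pr (line (inv_into dirs edge e) t)"
  have \<gamma>: "inv_into dirs edge (edge d) = d" if "d \<in> D" for d
    using that D inv_into_f_f[OF edge_inj] by auto
  have supp_lift: "\<exists>z. x = pr z \<and> z \<notin> half_lat" if "x \<in> graph_support (line_graph D)" for x
    using that D line_notin_half_lat unfolding graph_support_line_graph[OF D] by blast
  show ?thesis
    unfolding generic_def
  proof (intro conjI exI[of _ ?\<gamma>] ballI impI)
    show "tphi ` graph_support (line_graph D) \<inter> tphi ` critical_points torus CP1 tphi = {}"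
    proof -
      have False if x: "x \<in> graph_support (line_graph D)" and c: "c \<in> half_lat" "tphi x = tphi (pr c)" for x c
      proof -
        obtain z where z: "x = pr z" "z \<notin> half_lat" using supp_lift[OF x] by blast
        then have "c \<in> pm z"
          using c(2) ephi_fibre[OF z(2), of c] by simp
        then show False
          using half_lat_pm c(1) z(2) by blast
      qed
      then show ?thesis
        unfolding critical_points_tphi by blast
    qed
    fix e assume "e \<in> edges (line_graph D)"
    then obtain d where d: "d \<in> D" "e = edge d" by auto
    then show "edge_param (surf_top torus) (verts (line_graph D)) e (?\<gamma> e)"
      using edge_param_line D \<gamma>[OF d(1)] by auto
    show "immersed_open_curve CP1 (tphi \<circ> ?\<gamma> e)"
      using immersed_open_curve_line D d \<gamma>[OF d(1)] by (auto simp: o_def)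
  next
    fix x y assume x: "x \<in> graph_support (line_graph D)" and y: "y \<in> graph_support (line_graph D)"
      and xy: "x \<noteq> y \<and> tphi x = tphi y"
    obtain d d' s t where dd: "d \<in> D" "d' \<in> D" "s \<in> {0<..<1}" "t \<in> {0<..<1}"
      "x = pr (line d s)" "y = pr (line d' t)" "line d s + line d' t \<in> lat"
      using line_graph_coincidence[OF D x y] xy by metis
    have dirs: "d \<in> dirs" "d' \<in> dirs" using dd D by auto
    have y': "y = pr (- line d s)"
      using dd(7) unfolding dd(6) pr_eq_iff by (simp add: add.commute)
    have "z = x \<or> z = y" if z: "z \<in> graph_support (line_graph D)" "tphi z = tphi x" for z
    proof -
      obtain w where w: "z = pr w" using supp_lift[OF z(1)] by blast
      then have "w \<in> pm (line d s)"
        using z(2) dd(5) ephi_fibre[OF line_notin_half_lat[OF dirs(1)]] by simp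
      then show ?thesis
        using w dd(5) y' by (simp add: pm_iff_pr)
    qed
    then show "{z \<in> graph_support (line_graph D). tphi z = tphi x} = {x, y}"
      using x y xy by auto
    have "transverse_at CP1 (tphi \<circ> ?\<gamma> (edge d)) s (tphi \<circ> ?\<gamma> (edge d')) t"
      using transverse_at_lines[OF dirs dd(7)] \<gamma>[OF dd(1)] \<gamma>[OF dd(2)] by (simp add: o_def)
    then show "\<exists>e\<in>edges (line_graph D). \<exists>e'\<in>edges (line_graph D). \<exists>s\<in>{0<..<1}. \<exists>t\<in>{0<..<1}.
        x = ?\<gamma> e s \<and> y = ?\<gamma> e' t \<and> transverse_at CP1 (tphi \<circ> ?\<gamma> e) s (tphi \<circ> ?\<gamma> e') t"
      using dd \<gamma>[OF dd(1)] \<gamma>[OF dd(2)]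
      by (intro bexI[of _ "edge d"] bexI[of _ "edge d'"] bexI[of _ s] bexI[of _ t]) auto
  qed
qed

lemma crossings_two: "crossings tphi (line_graph {1, \<i>}) \<le> 1"
proof -
  have D: "{1, \<i>} \<subseteq> dirs" "{1, \<i>} \<noteq> {}" by (auto simp: dirs_def)
  \<comment> \<open>The real part of the sum is \<open>1/3 + s\<close>, which is an integer for just
    one \<open>s\<close> in the open interval; this fixes the double point.\<close>
  have param: "s = 2/3" if "s \<in> {0<..<1}" "line 1 s + line \<i> t \<in> lat" for s t
  proof -
    have "1/3 + s \<in> \<int>"
      using that(2) by (simp add: lat_def Re_line Im_line)
    then have "1/3 + s - 1 \<in> \<int>"
      by (intro Ints_diff) auto
    then have "1/3 + s - 1 = 0"
      using that(1) by (intro Ints_nonzero_abs_less1) auto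
    then show ?thesis by simp
  qed
  have "double_points tphi (line_graph {1, \<i>}) \<subseteq> {ephi (line 1 (2/3))}"
  proof
    fix q assume "q \<in> double_points tphi (line_graph {1, \<i>})"
    then obtain x y where xy: "x \<in> graph_support (line_graph {1, \<i>})" "y \<in> graph_support (line_graph {1, \<i>})"
      "x \<noteq> y" "tphi x = q" "tphi y = q"
      unfolding double_points_def by blast
    obtain d d' s t where dd: "d \<in> {1, \<i>}" "d' \<in> {1, \<i>}" "s \<in> {0<..<1}" "t \<in> {0<..<1}"
      "x = pr (line d s)" "y = pr (line d' t)" "line d s + line d' t \<in> lat"
      using line_graph_coincidence[OF D xy(1-3)] xy(4,5) by metis
    have "d \<noteq> d'"
      using line_reflect dd D by blast
    then consider "d = 1" "d' = \<i>" | "d = \<i>" "d' = 1"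
      using dd(1,2) by blast
    then show "q \<in> {ephi (line 1 (2/3))}"
    proof cases
      case 1
      have "s = 2/3"
        using param[OF dd(3), of t] dd(7) 1 by blast
      then show ?thesis using dd(5) xy(4) 1 by (metis singletonI tphi_pr)
    next
      case 2
      then have "line 1 t + line \<i> s \<in> lat" using dd(7) by (simp add: add.commute)
      then have "t = 2/3"
        using param[OF dd(4)] by blast
      then show ?thesis using dd(6) xy(5) 2 by (metis singletonI tphi_pr)
    qed
  qed
  then show ?thesis
    unfolding crossings_def using card_mono[of "{ephi (line 1 (2/3))}"] by fastforce
qed

lemma self_in_graph_class: "\<Gamma> \<in> graph_class X \<Gamma>"
proof -
  have "id \<in> Homeo0 X"
    by (simp add: Homeo0_def homotopic_with_refl)
  moreover have "graph_image id \<Gamma> = \<Gamma>"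
    by (simp add: graph_image_def)
  ultimately show ?thesis
    unfolding graph_class_def by (metis image_eqI)
qed

section \<open>Crossings forced by the homotopy class\<close>

lemma continuous_cis_lift:
  fixes f :: "'a::real_normed_vector \<Rightarrow> complex"
  assumes "continuous_on S f" "contractible S" "\<And>x. x \<in> S \<Longrightarrow> cmod (f x) = 1"
  obtains g where "continuous_on S g" "\<And>x. x \<in> S \<Longrightarrow> f x = cis (2 * pi * g x)"
proof -
  have "f x \<noteq> 0" if "x \<in> S" for x
    using assms(3)[OF that] by auto
  then obtain G where G: "continuous_on S G" "\<And>x. x \<in> S \<Longrightarrow> f x = exp (G x)"
    using continuous_logarithm_on_contractible[OF assms(1,2)] by metis
  have "f x = cis (2 * pi * (Im (G x) / (2 * pi)))" if "x \<in> S" for x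
  proof -
    have "exp (Re (G x)) = 1"
      using assms(3)[OF that] G(2)[OF that] by (simp add: norm_exp_eq_Re)
    then show ?thesis
      using G(2)[OF that] by (simp add: exp_eq_polar)
  qed
  moreover have "continuous_on S (\<lambda>x. Im (G x) / (2 * pi))"
    using G(1) by (intro continuous_intros) auto
  ultimately show ?thesis
    using that by blast
qed

lemma lat_valued_constant:
  fixes f :: "'a::topological_space \<Rightarrow> complex"
  assumes "connected S" "continuous_on S f" "\<And>x. x \<in> S \<Longrightarrow> f x \<in> lat" "x \<in> S" "y \<in> S"
  shows "f x = f y"
proof -
  have "f constant_on S"
  proof (rule continuous_discrete_range_constant[OF assms(1,2)])
    fix x assume "x \<in> S"
    then have "1 \<le> cmod (f y - f x)" if "y \<in> S" "f y \<noteq> f x" for y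
      using that assms(3) lat_norm_less_1[of "f y - f x"] lat_diff not_le_imp_less by fastforce
    then show "\<exists>e>0. \<forall>y. y \<in> S \<and> f y \<noteq> f x \<longrightarrow> e \<le> cmod (f y - f x)"
      using zero_less_one by blast
  qed
  then show ?thesis
    using assms(4,5) by (metis constant_on_def)
qed

text \<open>A lift of an arbitrary homeomorphism commutes with lattice translations only up to an
  automorphism of the lattice. Lifting the whole homotopy over the contractible strip
  \<open>S\<close> shows that this automorphism is trivial, because it is so for the identity at
  time 1.\<close>

lemma Homeo0_lift:
  assumes "h \<in> Homeo0 torus_top"
  obtains H where "continuous_on UNIV H" "\<And>z. pr (H z) = h (pr z)"
    "\<And>z l. l \<in> lat \<Longrightarrow> H (z + l) = H z + l"
proof -
  obtain k where k: "continuous_map (prod_topology (top_of_set {0..1::real}) torus_top) torus_top k"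
    "\<And>x. k (0, x) = h x" "\<And>x. k (1, x) = x"
    using assms unfolding Homeo0_def homotopic_with_def by auto
  define S where "S = {0..1::real} \<times> (UNIV :: complex set)"
  have S: "contractible S" "connected S"
    unfolding S_def by (auto intro!: convex_imp_contractible convex_connected convex_Times)
  define K where "K = (\<lambda>p. k (fst p, pr (snd p)))"
  have prodS: "prod_topology (top_of_set {0..1::real}) (euclidean :: complex topology) = top_of_set S"
    unfolding S_def using prod_topology_subtopology_eu[of "{0..1::real}" "UNIV :: complex set"]
    by (simp add: prod_topology_subtopology_eu)
  have "continuous_map (top_of_set S) (prod_topology (top_of_set {0..1::real}) torus_top) (\<lambda>p. (fst p, pr (snd p)))"
    unfolding prodS[symmetric]
    by (intro continuous_map_pairedI continuous_map_fst continuous_map_compose[OF continuous_map_snd continuous_map_pr, unfolded o_def])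
  then have K: "continuous_map (top_of_set S) torus_top K"
    using continuous_map_compose[OF _ k(1)] by (simp add: o_def K_def)
  have "continuous_on S (the2 \<circ> K)"
    using continuous_map_compose[OF K continuous_map_the2] by simp
  then have cont: "continuous_on S (\<lambda>p. fst (the2 (K p)))" "continuous_on S (\<lambda>p. snd (the2 (K p)))"
    by (auto intro: continuous_intros simp: o_def)
  have Kr: "K p \<in> range pr" if "p \<in> S" for p
    using continuous_map_image_subset_topspace[OF K] that by auto
  moreover have "cmod (fst (the2 q)) = 1" "cmod (snd (the2 q)) = 1" if "q \<in> range pr" for q
    using that by (auto simp: the2_pr)
  ultimately have norm: "cmod (fst (the2 (K p))) = 1" "cmod (snd (the2 (K p))) = 1" if "p \<in> S" for p
    using that by blast+
  obtain g1 where g1: "continuous_on S g1" "\<And>p. p \<in> S \<Longrightarrow> fst (the2 (K p)) = cis (2 * pi * g1 p)"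
    using continuous_cis_lift[OF cont(1) S(1) norm(1)] by metis
  obtain g2 where g2: "continuous_on S g2" "\<And>p. p \<in> S \<Longrightarrow> snd (the2 (K p)) = cis (2 * pi * g2 p)"
    using continuous_cis_lift[OF cont(2) S(1) norm(2)] by metis
  define L where "L p = Complex (g1 p) (g2 p)" for p
  have L: "continuous_on S L"
    unfolding L_def[abs_def] Complex_eq using g1(1) g2(1) by (intro continuous_intros)
  have pL: "pr (L p) = K p" if "p \<in> S" for p
  proof -
    have "the2 (pr (L p)) = the2 (K p)"
      using g1(2)[OF that] g2(2)[OF that] by (simp add: the2_pr L_def prod_eq_iff)
    then show ?thesis
      using inj_onD[OF inj_on_the2 _ _ Kr[OF that]] by blast
  qed
  have inS: "(0, z) \<in> S" "(1, z) \<in> S" for z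
    by (auto simp: S_def)
  have one: "L (1, z) - z = L (1, w) - w" for z w
  proof (rule lat_valued_constant[of UNIV "\<lambda>z. L (1, z) - z"])
    show "continuous_on UNIV (\<lambda>z. L (1, z) - z)"
      by (intro continuous_intros continuous_on_compose2[OF L]) (auto simp: inS)
    show "L (1, z) - z \<in> lat" for z
      using pL[OF inS(2)] k(3) by (simp add: K_def flip: pr_eq_iff)
  qed auto
  \<comment> \<open>The defect \<open>?M\<close> takes values in the lattice, so it is constant on
    the connected strip and can be evaluated at time 1, where the lift is a translation.\<close>
  have per: "L (0, z + l) = L (0, z) + l" if l: "l \<in> lat" for z l
  proof -
    let ?M = "\<lambda>p. L (fst p, snd p + l) - L p - l"
    have "?M (0, z) = ?M (1, 0)"
    proof (rule lat_valued_constant[OF S(2), of ?M])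
      show "continuous_on S ?M"
        by (intro continuous_intros L continuous_on_compose2[OF L]) (auto simp: S_def)
      fix p assume p: "p \<in> S"
      then have p': "(fst p, snd p + l) \<in> S" by (auto simp: S_def)
      have "pr (L (fst p, snd p + l)) = pr (L p)"
        using pL[OF p] pL[OF p'] pr_add_lat[OF l] by (simp add: K_def)
      then show "?M p \<in> lat"
        using l by (simp add: pr_eq_iff lat_diff)
    qed (auto simp: inS)
    then show ?thesis
      using one[of l 0] by (simp add: algebra_simps)
  qed
  show ?thesis
  proof
    show "continuous_on UNIV (\<lambda>z. L (0, z))"
      by (intro continuous_on_compose2[OF L] continuous_intros) (auto simp: inS)
    show "pr (L (0, z)) = h (pr z)" for z
      using pL[OF inS(1)] k(2) by (simp add: K_def)
  qed (rule per)
qed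

text \<open>
  Solving \<open>f t = g s\<close> means finding a fixed point of the bounded map that inverts the linear
  part \<open>t * a - s * b\<close>, so Brouwer's theorem applies on a large disk.
\<close>

lemma transverse_asymptotic_lines_meet:
  fixes f g :: "real \<Rightarrow> complex"
  assumes "continuous_on UNIV f" "continuous_on UNIV g"
    and "\<And>t. cmod (f t - of_real t * a) \<le> M" "\<And>t. cmod (g t - of_real t * b) \<le> M"
    and det: "Re a * Im b - Im a * Re b \<noteq> 0"
  obtains s t where "f s = g t"
proof -
  define \<Delta> where "\<Delta> = Re a * Im b - Im a * Re b"
  \<comment> \<open>Cramer's rule for \<open>Re w * a - Im w * b = v\<close>, with the two real
    unknowns packed into one complex number \<open>w\<close>.\<close>
  define \<Lambda> where "\<Lambda> v = Complex ((Re v * Im b - Re b * Im v) / \<Delta>) ((Im a * Re v - Re a * Im v) / \<Delta>)" for v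
  have inv: "of_real (Re (\<Lambda> v)) * a - of_real (Im (\<Lambda> v)) * b = v" for v
  proof -
    have "\<Delta> \<noteq> 0" using det by (simp add: \<Delta>_def)
    moreover have "(Re v * Im b - Re b * Im v) * Re a - (Im a * Re v - Re a * Im v) * Re b = \<Delta> * Re v"
      "(Re v * Im b - Re b * Im v) * Im a - (Im a * Re v - Re a * Im v) * Im b = \<Delta> * Im v"
      by (simp_all add: \<Delta>_def algebra_simps)
    ultimately have "(Re v * Im b - Re b * Im v) / \<Delta> * Re a - (Im a * Re v - Re a * Im v) / \<Delta> * Re b = Re v"
      "(Re v * Im b - Re b * Im v) / \<Delta> * Im a - (Im a * Re v - Re a * Im v) / \<Delta> * Im b = Im v"
      by (simp_all only: times_divide_eq_left diff_divide_distrib[symmetric] nonzero_mult_div_cancel_left not_False_eq_True)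
    then show ?thesis
      by (simp add: complex_eq_iff \<Lambda>_def)
  qed
  have cont: "continuous_on UNIV \<Lambda>"
    unfolding \<Lambda>_def[abs_def] Complex_eq by (intro continuous_intros) (use det in \<open>auto simp: \<Delta>_def\<close>)
  \<comment> \<open>The bounded part of the equation: \<open>f (Re w) = g (Im w)\<close> says that
    \<open>Re w * a - Im w * b = R w\<close>, that is, \<open>w\<close> is fixed by
    \<open>\<Lambda> \<circ> R\<close>.\<close>
  define R where "R w = (of_real (Re w) * a - f (Re w)) - (of_real (Im w) * b - g (Im w))" for w
  have contR: "continuous_on UNIV R"
    unfolding R_def[abs_def]
    by (intro continuous_intros continuous_on_compose2[OF assms(1)] continuous_on_compose2[OF assms(2)]) auto
  have R: "R w \<in> cball 0 (2 * M)" for w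
  proof -
    have "cmod (R w) \<le> cmod (of_real (Re w) * a - f (Re w)) + cmod (of_real (Im w) * b - g (Im w))"
      unfolding R_def by (rule norm_triangle_ineq4)
    also have "\<dots> \<le> M + M"
      using assms(3,4) by (intro add_mono) (simp_all add: norm_minus_commute)
    finally show ?thesis by simp
  qed
  have "bounded (\<Lambda> ` cball 0 (2 * M))"
    by (intro compact_imp_bounded compact_continuous_image continuous_on_subset[OF cont]) auto
  then obtain C where C: "\<And>v. v \<in> cball 0 (2 * M) \<Longrightarrow> cmod (\<Lambda> v) \<le> C"
    unfolding bounded_iff by blast
  have "cmod (\<Lambda> (R 0)) \<le> C" using C R by blast
  then have "0 \<le> C" using norm_ge_zero order_trans by blast
  moreover have "continuous_on UNIV (\<Lambda> \<circ> R)"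
    by (rule continuous_on_compose[OF contR continuous_on_subset[OF cont]]) simp
  then have "continuous_on (cball 0 C) (\<Lambda> \<circ> R)"
    by (rule continuous_on_subset) simp
  moreover have "\<Lambda> \<circ> R \<in> cball 0 C \<rightarrow> cball 0 C"
    using C R by auto
  ultimately obtain w where "w \<in> cball 0 C" "(\<Lambda> \<circ> R) w = w"
    using brouwer[of "cball 0 C" "\<Lambda> \<circ> R"] by auto
  then have "of_real (Re w) * a - of_real (Im w) * b = R w"
    using inv[of "R w"] by simp
  then have "f (Re w) = g (Im w)"
    by (simp add: R_def algebra_simps)
  then show ?thesis by (rule that)
qed

section \<open>Forced crossings\<close>

text \<open>The displacement \<open>H z - z\<close> is periodic, hence bounded by its values on the
  unit square. So \<open>H\<close> and \<open>- H\<close> keep the two lines near lines of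
  directions \<open>d\<close> and \<open>- d'\<close>, which are not parallel.\<close>

lemma lift_meets_reflection:
  assumes H: "continuous_on UNIV H" "\<And>z l. l \<in> lat \<Longrightarrow> H (z + l) = H z + l"
    and d: "d \<in> dirs" "d' \<in> dirs" "d \<noteq> d'"
  obtains s t where "H (line d s) + H (line d' t) = 0"
proof -
  have "bounded ((\<lambda>z. H z - z) ` cbox 0 (1 + \<i>))"
    by (intro compact_imp_bounded compact_continuous_image continuous_intros continuous_on_subset[OF H(1)]) auto
  then obtain B where B: "\<And>z. z \<in> cbox 0 (1 + \<i>) \<Longrightarrow> cmod (H z - z) \<le> B"
    unfolding bounded_iff by blast
  have bd: "cmod (H z - z) \<le> B" for z
  proof -
    obtain l where l: "l \<in> lat" "z - l \<in> cbox 0 (1 + \<i>)"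
      by (rule reduce_mod_lat)
    have "H z - z = H (z - l) - (z - l)"
      using H(2)[OF l(1), of "z - l"] by simp
    then show ?thesis
      using B[OF l(2)] by (simp only:)
  qed
  have bound: "cmod (H (line e t) - of_real t * e) \<le> B + cmod zbase" for e t
  proof -
    have "H (line e t) - of_real t * e = (H (line e t) - line e t) + zbase"
      by (simp add: line_def)
    then have "cmod (H (line e t) - of_real t * e) \<le> cmod (H (line e t) - line e t) + cmod zbase"
      by (simp only: norm_triangle_ineq)
    then show ?thesis
      using bd[of "line e t"] by linarith
  qed
  have bound': "cmod (- H (line e t) - of_real t * (- e)) \<le> B + cmod zbase" for e t
    using bound[of e t] by (metis (no_types, lifting) minus_diff_minus mult_minus_right norm_minus_cancel)
  have cont: "continuous_on UNIV (\<lambda>t. H (line e t))" for e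
    by (intro continuous_on_compose2[OF H(1)] continuous_on_line) auto
  obtain s t where "H (line d s) = - H (line d' t)"
  proof (rule transverse_asymptotic_lines_meet[OF cont continuous_on_minus[OF cont] bound bound'])
    show "Re d * Im (- d') - Im d * Re (- d') \<noteq> 0"
      using d by (elim dirs_cases) auto
  qed
  then show ?thesis
    using that[of s t] by simp
qed

text \<open>The fixed point argument gives arbitrary real parameters; discarding whole periods leads
  back to the graph.\<close>

lemma pr_line_in_closed_edge:
  assumes "d \<in> dirs" shows "pr (line d t) \<in> insert (pr zbase) (edge d)"
proof -
  have "of_real (of_int \<lfloor>t\<rfloor>) * d \<in> lat"
    using assms by (auto simp: dirs_def lat_def)
  moreover have "line d t = line d (frac t) + of_real (of_int \<lfloor>t\<rfloor>) * d"
    by (simp add: line_def frac_def algebra_simps)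
  ultimately have "pr (line d t) = pr (line d (frac t))"
    by (simp add: pr_eq_iff)
  then show ?thesis
    using frac_ge_0[of t] frac_lt_1[of t] unfolding closed_edge_eq[OF assms]
    by (auto intro!: image_eqI[of _ _ "frac t"])
qed

section \<open>Double points of generic graphs\<close>

lemma generic_support_notin_half_lat:
  assumes "generic torus tphi \<Gamma>" "pr z \<in> graph_support \<Gamma>" shows "z \<notin> half_lat"
proof
  assume "z \<in> half_lat"
  have "tphi ` graph_support \<Gamma> \<inter> tphi ` pr ` half_lat = {}"
    using assms(1) unfolding generic_def critical_points_tphi by (rule conjunct1)
  then show False
    using assms(2) \<open>z \<in> half_lat\<close> by blast
qed

text \<open>A forced crossing is found on closed loops, which share the vertex. This assigns each of
  its points to one definite open edge.\<close>

lemma generic_coincidence_not_vertex: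
  assumes "generic torus tphi \<Gamma>" "x \<in> graph_support \<Gamma>" "y \<in> graph_support \<Gamma>"
    "x \<noteq> y" "tphi x = tphi y"
  shows "x \<notin> verts \<Gamma>" "y \<notin> verts \<Gamma>"
proof -
  obtain \<gamma> e e' s t where "edge_param torus_top (verts \<Gamma>) e (\<gamma> e)" "edge_param torus_top (verts \<Gamma>) e' (\<gamma> e')"
    "s \<in> {0<..<1}" "t \<in> {0<..<1}" "x = \<gamma> e s" "y = \<gamma> e' t"
    using assms unfolding generic_def surf_top_torus by blast
  then show "x \<notin> verts \<Gamma>" "y \<notin> verts \<Gamma>"
    unfolding edge_param_def by blast+
qed

text \<open>The derivative of \<open>c s - d t\<close> in both variables is an injective linear map,
  hence bounded below by \<open>B * norm v\<close>; close to the crossing the remainder is at most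
  half of this and cannot cancel it.\<close>

lemma transverse_curves_isolated_crossing:
  fixes c d :: "real \<Rightarrow> complex"
  assumes "(c has_vector_derivative a) (at s0)" "(d has_vector_derivative b) (at t0)"
    and "c s0 = d t0" "\<not> collinear {0, a, b}"
  shows "\<forall>\<^sub>F p in at (s0, t0). c (fst p) \<noteq> d (snd p)"
proof -
  define G where "G p = c (fst p) - d (snd p)" for p
  define L where "L v = fst v *\<^sub>R a - snd v *\<^sub>R b" for v :: "real \<times> real"
  have "(G has_derivative L) (at (s0, t0))"
    unfolding G_def[abs_def] L_def[abs_def]
  proof (rule has_derivative_diff)
    show "((\<lambda>p. c (fst p)) has_derivative (\<lambda>v. fst v *\<^sub>R a)) (at (s0, t0))"
      using assms(1) unfolding has_vector_derivative_def
      by (intro has_derivative_compose[of fst fst "(s0, t0)" UNIV c "\<lambda>x. x *\<^sub>R a", simplified]) (auto intro!: derivative_eq_intros)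
    show "((\<lambda>p. d (snd p)) has_derivative (\<lambda>v. snd v *\<^sub>R b)) (at (s0, t0))"
      using assms(2) unfolding has_vector_derivative_def
      by (intro has_derivative_compose[of snd snd "(s0, t0)" UNIV d "\<lambda>x. x *\<^sub>R b", simplified]) (auto intro!: derivative_eq_intros)
  qed
  then have der: "bounded_linear L" "\<And>e. e > 0 \<Longrightarrow> \<exists>r>0. \<forall>p. norm (p - (s0, t0)) < r \<longrightarrow>
      norm (G p - G (s0, t0) - L (p - (s0, t0))) \<le> e * norm (p - (s0, t0))"
    unfolding has_derivative_at_alt by blast+
  have lin: "linear L"
    using der(1) bounded_linear.linear by blast
  have "inj L"
    unfolding linear_injective_0[OF lin]
  proof clarify
    fix h k :: real assume "L (h, k) = 0"
    then have eq: "h *\<^sub>R a = k *\<^sub>R b" by (simp add: L_def)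
    have "k = 0"
    proof (rule ccontr)
      assume "k \<noteq> 0"
      then have "b = (h / k) *\<^sub>R a"
        using arg_cong[OF eq, of "\<lambda>x. (1 / k) *\<^sub>R x"] by simp
      then show False
        using assms(4) unfolding collinear_lemma by blast
    qed
    moreover have "a \<noteq> 0"
      using assms(4) unfolding collinear_lemma by blast
    ultimately show "(h, k) = 0"
      using eq by (simp add: zero_prod_def)
  qed
  then obtain B where B: "B > 0" "\<And>v. B * norm v \<le> norm (L v)"
    using linear_inj_bounded_below_pos[OF lin] by blast
  obtain r where r: "r > 0" "\<And>p. norm (p - (s0, t0)) < r \<Longrightarrow>
      norm (G p - G (s0, t0) - L (p - (s0, t0))) \<le> B / 2 * norm (p - (s0, t0))"
    using der(2)[of "B / 2"] B(1) by auto
  have "c (fst p) \<noteq> d (snd p)" if p: "p \<noteq> (s0, t0)" "dist p (s0, t0) < r" for p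
  proof
    assume "c (fst p) = d (snd p)"
    then have "norm (L (p - (s0, t0))) \<le> B / 2 * norm (p - (s0, t0))"
      using r(2)[of p] p(2) assms(3) by (simp add: G_def dist_norm)
    then have "B * norm (p - (s0, t0)) \<le> B / 2 * norm (p - (s0, t0))"
      using B(2)[of "p - (s0, t0)"] by linarith
    moreover have "B * norm (p - (s0, t0)) > 0"
      using B(1) p(1) by simp
    ultimately show False by simp
  qed
  then show ?thesis
    unfolding eventually_at using r(1) by blast
qed

text \<open>The hyperelliptic involution \<open>z \<mapsto> - z\<close>, the deck transformation of \<open>tphi\<close>.\<close>

definition tneg :: "cp1 \<times> cp1 \<Rightarrow> cp1 \<times> cp1" where
  "tneg p = pr (- inv_into UNIV pr p)"

lemma tneg_pr [simp]: "tneg (pr z) = pr (- z)"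
proof -
  have "pr (inv_into UNIV pr (pr z)) = pr z"
    by (simp add: f_inv_into_f)
  then have "- (inv_into UNIV pr (pr z) - z) \<in> lat"
    unfolding lat_minus_iff pr_eq_iff .
  then show ?thesis
    by (simp add: tneg_def pr_eq_iff)
qed

lemma continuous_map_tneg: "continuous_map torus_top torus_top tneg"
proof -
  have "tneg \<circ> pr = pr \<circ> uminus" by auto
  moreover have "continuous_map euclidean torus_top (pr \<circ> uminus)"
    by (rule continuous_map_compose[OF _ continuous_map_pr]) (simp add: continuous_on_minus)
  ultimately show ?thesis
    by (simp add: continuous_map_torus_iff)
qed

lemma generic_coincidence_tneg:
  assumes "generic torus tphi \<Gamma>" "x \<in> graph_support \<Gamma>" "graph_support \<Gamma> \<subseteq> range pr"
    "y \<in> range pr" "tphi x = tphi y" "x \<noteq> y"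
  shows "y = tneg x"
proof -
  obtain z w where zw: "x = pr z" "y = pr w"
    using assms(2-4) by blast
  have "z \<notin> half_lat"
    using generic_support_notin_half_lat assms(1,2) zw by blast
  then have "w \<in> pm z"
    using assms(5) zw ephi_fibre[of z w] by (metis tphi_pr)
  then show ?thesis
    using zw assms(6) by (auto simp: pm_iff_pr)
qed

lemma tneg_not_fixed:
  assumes "generic torus tphi \<Gamma>" "x \<in> graph_support \<Gamma>" "graph_support \<Gamma> \<subseteq> range pr"
  shows "tneg x \<noteq> x" "tphi (tneg x) = tphi x"
proof -
  obtain z where z: "x = pr z"
    using assms(2,3) by blast
  have "z \<notin> half_lat"
    using generic_support_notin_half_lat assms(1,2) z by blast
  then show "tneg x \<noteq> x"
    using lat_minus_iff[of "2 * z"] by (simp add: z pr_eq_iff half_lat_def)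
  show "tphi (tneg x) = tphi x"
    unfolding z by (simp add: ephi_pm pm_def)
qed

lemma openin_charts_CP1: "(V, k) \<in> surf_charts CP1 \<Longrightarrow> openin (surf_top CP1) V"
proof -
  have "openin (surf_top CP1) (range Some)"
    by (simp add: surf_top_CP1)
  moreover have "closedin (surf_top CP1) (Some ` {0})"
    unfolding surf_top_CP1 closedin_Alexandroff_compactification_image_Some by simp
  then have "openin (surf_top CP1) (- {Some 0})"
    unfolding closedin_def topspace_CP1 by (simp add: Compl_eq_Diff_UNIV)
  ultimately show "(V, k) \<in> surf_charts CP1 \<Longrightarrow> openin (surf_top CP1) V"
    by (auto simp: surf_charts_CP1)
qed

lemma charts_CP1_cover: obtains V k where "(V, k) \<in> surf_charts CP1" "q \<in> V"
  by (cases q) (auto simp: surf_charts_CP1)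

lemma immersed_open_curve_derivative:
  assumes "pathin (surf_top CP1) c" "immersed_open_curve CP1 c" "(V, k) \<in> surf_charts CP1"
    "s \<in> {0<..<1}" "c s \<in> V"
  shows "(k \<circ> c has_vector_derivative vector_derivative (k \<circ> c) (at s)) (at s)"
proof -
  \<comment> \<open>Two-sided derivatives need an open parameter set, while \<open>c\<close> is
    known to be continuous only on the closed interval; cutting down to the open interval gives
    openness in the reals.\<close>
  define T where "T = {t \<in> {0<..<1}. c t \<in> V}"
  have "openin (top_of_set {0..1}) {t \<in> topspace (top_of_set {0..1}). c t \<in> V}"
    using assms(1) openin_charts_CP1[OF assms(3)] unfolding pathin_def
    by (rule openin_continuous_map_preimage)
  then obtain O' where O': "open O'" "{t \<in> {0..1}. c t \<in> V} = {0..1} \<inter> O'"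
    by (auto simp: openin_open)
  have "T = {0<..<1} \<inter> {t \<in> {0..1}. c t \<in> V}"
    by (auto simp: T_def)
  also have "\<dots> = {0<..<1} \<inter> O'"
    unfolding O'(2) by auto
  finally have "open T"
    using O'(1) by (simp add: open_Int)
  have "s \<in> T"
    using assms(4,5) unfolding T_def by blast
  note T = \<open>open T\<close> \<open>s \<in> T\<close>
  have "smooth_on T (k \<circ> c)"
    using assms(2,3) unfolding immersed_open_curve_def Let_def T_def by blast
  then obtain D where D: "\<forall>t\<in>T. D 0 t = (k \<circ> c) t" "\<forall>n. \<forall>t\<in>T. (D n has_vector_derivative D (Suc n) t) (at t)"
    unfolding smooth_on_def by blast
  have "(D 0 has_vector_derivative D 1 s) (at s)"
    using D(2) T(2) by (metis One_nat_def)
  then have "(k \<circ> c has_vector_derivative D 1 s) (at s)"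
    by (rule has_vector_derivative_transform_within_open[OF _ T]) (use D(1) in blast)
  then show ?thesis
    using vector_derivative_works differentiableI_vector by blast
qed

lemma edge_param_subset_support:
  assumes "edge_param X (verts \<Gamma>) e c" "e \<in> edges \<Gamma>" "t \<in> {0..1}"
  shows "c t \<in> graph_support \<Gamma>" "c t \<notin> verts \<Gamma> \<Longrightarrow> t \<in> {0<..<1}"
proof -
  have "{0..1::real} = insert 0 (insert 1 {0<..<1})"
    by auto
  then have "t = 0 \<or> t = 1 \<or> t \<in> {0<..<1}"
    using assms(3) by blast
  then show "c t \<in> graph_support \<Gamma>" "c t \<notin> verts \<Gamma> \<Longrightarrow> t \<in> {0<..<1}"
    using assms(1,2) unfolding edge_param_def graph_support_def by blast+
qed

text \<open>Genericity provides transversality for some edges and parameters of a crossing; this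
  identifies them with the ones at hand.\<close>

lemma edge_param_unique:
  assumes "edge_param X (verts \<Gamma>) e c" "e \<in> edges \<Gamma>" "edge_param X (verts \<Gamma>) e' c'" "e' \<in> edges \<Gamma>"
    "pairwise disjnt (edges \<Gamma>)" "s \<in> {0<..<1}" "t \<in> {0<..<1}" "c s = c' t"
  shows "e = e'" "c = c' \<Longrightarrow> s = t"
proof -
  have "c s \<in> e \<inter> e'"
    using assms unfolding edge_param_def by blast
  then show "e = e'"
    using assms(2,4,5) unfolding pairwise_def disjnt_def by blast
  show "s = t" if "c = c'"
    using assms(1,6-8) that unfolding edge_param_def by (auto dest: inj_onD)
qed

text \<open>Infinitely many crossings would have an accumulation point in the compact square of
  parameters. The pair of graph points there is again exchanged by \<open>tneg\<close>, hence
  distinct and a transverse crossing, and such crossings are isolated.\<close>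

lemma finite_double_points:
  assumes gen: "generic torus tphi \<Gamma>" and fin: "finite (edges \<Gamma>)"
    and disj: "pairwise disjnt (edges \<Gamma>)" and supp: "graph_support \<Gamma> \<subseteq> range pr"
  shows "finite (double_points tphi \<Gamma>)"
proof -
  obtain \<gamma> where A: "\<forall>e\<in>edges \<Gamma>. edge_param torus_top (verts \<Gamma>) e (\<gamma> e) \<and>
       immersed_open_curve CP1 (tphi \<circ> \<gamma> e)"
    and B: "\<forall>x\<in>graph_support \<Gamma>. \<forall>y\<in>graph_support \<Gamma>. x \<noteq> y \<and> tphi x = tphi y \<longrightarrow>
       {z \<in> graph_support \<Gamma>. tphi z = tphi x} = {x, y} \<and>
       (\<exists>e\<in>edges \<Gamma>. \<exists>e'\<in>edges \<Gamma>. \<exists>s\<in>{0<..<1}. \<exists>t\<in>{0<..<1}. x = \<gamma> e s \<and> y = \<gamma> e' t \<and>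
         transverse_at CP1 (tphi \<circ> \<gamma> e) s (tphi \<circ> \<gamma> e') t)"
    using gen unfolding generic_def surf_top_torus by (elim conjE exE) (rule that)
  have \<gamma>: "edge_param torus_top (verts \<Gamma>) e (\<gamma> e)" "immersed_open_curve CP1 (tphi \<circ> \<gamma> e)"
    if "e \<in> edges \<Gamma>" for e
    using bspec[OF A that] by blast+
  have cross: "\<exists>e\<in>edges \<Gamma>. \<exists>e'\<in>edges \<Gamma>. \<exists>s\<in>{0<..<1}. \<exists>t\<in>{0<..<1}. x = \<gamma> e s \<and> y = \<gamma> e' t \<and>
         transverse_at CP1 (tphi \<circ> \<gamma> e) s (tphi \<circ> \<gamma> e') t"
    if "x \<in> graph_support \<Gamma>" "y \<in> graph_support \<Gamma>" "x \<noteq> y" "tphi x = tphi y" for x y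
    using bspec[OF bspec[OF B that(1)] that(2)] that(3,4) by blast
  define S where "S e e' = {p \<in> {0<..<1} \<times> {0<..<1}. \<gamma> e (fst p) \<noteq> \<gamma> e' (snd p) \<and>
     tphi (\<gamma> e (fst p)) = tphi (\<gamma> e' (snd p))}" for e e'
  have "finite (S e e')" if e: "e \<in> edges \<Gamma>" "e' \<in> edges \<Gamma>" for e e'
  proof (rule ccontr)
    assume "infinite (S e e')"
    let ?K = "{0..1::real} \<times> {0..1::real}"
    have paths: "continuous_map (top_of_set {0..1}) torus_top (\<gamma> e)" "continuous_map (top_of_set {0..1}) torus_top (\<gamma> e')"
      using \<gamma>(1) e unfolding edge_param_def pathin_def by blast+
    have sub: "S e e' \<subseteq> ?K" by (auto simp: S_def)
    moreover have "compact ?K" by (intro compact_Times) auto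
    ultimately obtain p where p: "p \<in> ?K" "p islimpt S e e'"
      using \<open>infinite (S e e')\<close> unfolding compact_eq_Bolzano_Weierstrass by blast
    obtain s0 t0 where st: "p = (s0, t0)" "s0 \<in> {0..1}" "t0 \<in> {0..1}"
      using p(1) by auto
    \<comment> \<open>Being distinct does not pass to limits, but being exchanged by
      \<open>tneg\<close> is a closed condition, and \<open>tneg\<close> fixes no point of a generic
      graph; so the two points cannot merge in the limit.\<close>
    define Z where "Z = {q \<in> ?K. \<gamma> e' (snd q) = tneg (\<gamma> e (fst q))}"
    have "closedin (top_of_set ?K) {q \<in> topspace (top_of_set ?K). (\<gamma> e' \<circ> snd) q = (tneg \<circ> \<gamma> e \<circ> fst) q}"
    proof (rule closedin_continuous_maps_eq[OF Hausdorff_torus])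
      have proj: "continuous_map (top_of_set ?K) (top_of_set {0..1}) snd"
        "continuous_map (top_of_set ?K) (top_of_set {0..1}) fst"
        by (auto intro!: continuous_intros)
      show "continuous_map (top_of_set ?K) torus_top (\<gamma> e' \<circ> snd)"
        by (rule continuous_map_compose[OF proj(1) paths(2)])
      show "continuous_map (top_of_set ?K) torus_top (tneg \<circ> \<gamma> e \<circ> fst)"
        by (rule continuous_map_compose[OF proj(2) continuous_map_compose[OF paths(1) continuous_map_tneg]])
    qed
    then have "closedin (top_of_set ?K) Z"
      by (simp add: Z_def)
    then have "closed Z"
      using closedin_closed_trans[of ?K Z] by (simp add: closed_Times)
    have "S e e' \<subseteq> Z"
    proof
      fix q assume q: "q \<in> S e e'"
      then have "\<gamma> e (fst q) \<in> graph_support \<Gamma>" "\<gamma> e' (snd q) \<in> graph_support \<Gamma>"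
        using edge_param_subset_support(1)[OF \<gamma>(1)] e by (auto simp: S_def)
      then show "q \<in> Z"
        using q sub generic_coincidence_tneg[OF gen _ supp] supp unfolding S_def Z_def by blast
    qed
    then have "p \<in> Z"
      using p(2) \<open>closed Z\<close> closed_limpt islimpt_subset by blast
    then have y: "\<gamma> e' t0 = tneg (\<gamma> e s0)"
      by (simp add: Z_def st(1))
    have in_supp: "\<gamma> e s0 \<in> graph_support \<Gamma>" "\<gamma> e' t0 \<in> graph_support \<Gamma>"
      using edge_param_subset_support(1)[OF \<gamma>(1)] e st by blast+
    have ne: "\<gamma> e s0 \<noteq> \<gamma> e' t0" and eq: "tphi (\<gamma> e s0) = tphi (\<gamma> e' t0)"
      using tneg_not_fixed[OF gen in_supp(1) supp] y by auto
    have nv: "\<gamma> e s0 \<notin> verts \<Gamma>" "\<gamma> e' t0 \<notin> verts \<Gamma>"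
      using generic_coincidence_not_vertex[OF gen in_supp ne eq] by blast+
    have op: "s0 \<in> {0<..<1}" "t0 \<in> {0<..<1}"
      using edge_param_subset_support(2)[OF \<gamma>(1)] e st nv by blast+
    obtain f f' s t where f: "f \<in> edges \<Gamma>" "f' \<in> edges \<Gamma>" "s \<in> {0<..<1}" "t \<in> {0<..<1}"
      "\<gamma> e s0 = \<gamma> f s" "\<gamma> e' t0 = \<gamma> f' t" "transverse_at CP1 (tphi \<circ> \<gamma> f) s (tphi \<circ> \<gamma> f') t"
      using cross[OF in_supp ne eq] by blast
    have "f = e" "f' = e'"
      using edge_param_unique(1)[OF \<gamma>(1) _ \<gamma>(1) _ disj] e f op by metis+
    moreover from this have "s = s0" "t = t0"
      using edge_param_unique(2)[OF \<gamma>(1) _ \<gamma>(1) _ disj] e f op by metis+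
    ultimately have tr: "transverse_at CP1 (tphi \<circ> \<gamma> e) s0 (tphi \<circ> \<gamma> e') t0"
      using f(7) by simp
    obtain V k where Vk: "(V, k) \<in> surf_charts CP1" "tphi (\<gamma> e s0) \<in> V"
      by (rule charts_CP1_cover)
    have pathC: "pathin (surf_top CP1) (tphi \<circ> \<gamma> g)" if "g \<in> edges \<Gamma>" for g
      using \<gamma>(1)[OF that] holomorphic_map_tphi continuous_map_compose
      unfolding edge_param_def pathin_def holomorphic_map_def surf_top_torus by blast
    have "\<forall>\<^sub>F q in at (s0, t0). (k \<circ> (tphi \<circ> \<gamma> e)) (fst q) \<noteq> (k \<circ> (tphi \<circ> \<gamma> e')) (snd q)"
    proof (rule transverse_curves_isolated_crossing)
      show "(k \<circ> (tphi \<circ> \<gamma> e) has_vector_derivative vector_derivative (k \<circ> (tphi \<circ> \<gamma> e)) (at s0)) (at s0)"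
        using Vk(2) by (intro immersed_open_curve_derivative[OF pathC[OF e(1)] \<gamma>(2)[OF e(1)] Vk(1) op(1)]) simp
      show "(k \<circ> (tphi \<circ> \<gamma> e') has_vector_derivative vector_derivative (k \<circ> (tphi \<circ> \<gamma> e')) (at t0)) (at t0)"
        using Vk(2) eq by (intro immersed_open_curve_derivative[OF pathC[OF e(2)] \<gamma>(2)[OF e(2)] Vk(1) op(2)]) simp
      show "(k \<circ> (tphi \<circ> \<gamma> e)) s0 = (k \<circ> (tphi \<circ> \<gamma> e')) t0"
        using eq by simp
      show "\<not> collinear {0, vector_derivative (k \<circ> (tphi \<circ> \<gamma> e)) (at s0), vector_derivative (k \<circ> (tphi \<circ> \<gamma> e')) (at t0)}"
        using tr Vk unfolding transverse_at_def by auto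
    qed
    then have "\<forall>\<^sub>F q in at p. q \<notin> S e e'"
      unfolding st(1) by eventually_elim (auto simp: S_def)
    then show False
      using p(2) by (simp add: islimpt_iff_eventually)
  qed
  then have "finite (\<Union>e\<in>edges \<Gamma>. \<Union>e'\<in>edges \<Gamma>. (\<lambda>p. tphi (\<gamma> e (fst p))) ` S e e')"
    using fin by (intro finite_UN_I finite_imageI)
  moreover have "double_points tphi \<Gamma> \<subseteq> (\<Union>e\<in>edges \<Gamma>. \<Union>e'\<in>edges \<Gamma>. (\<lambda>p. tphi (\<gamma> e (fst p))) ` S e e')"
  proof
    fix q assume "q \<in> double_points tphi \<Gamma>"
    then obtain x y where xy: "x \<in> graph_support \<Gamma>" "y \<in> graph_support \<Gamma>" "x \<noteq> y" "tphi x = q" "tphi y = q"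
      unfolding double_points_def by blast
    obtain e e' s t where "e \<in> edges \<Gamma>" "e' \<in> edges \<Gamma>" "s \<in> {0<..<1}" "t \<in> {0<..<1}" "x = \<gamma> e s" "y = \<gamma> e' t"
      using cross[OF xy(1-3) trans[OF xy(4) xy(5)[symmetric]]] by blast
    then show "q \<in> (\<Union>e\<in>edges \<Gamma>. \<Union>e'\<in>edges \<Gamma>. (\<lambda>p. tphi (\<gamma> e (fst p))) ` S e e')"
      using xy by (intro UN_I[of e] UN_I[of e'] image_eqI[of _ _ "(s, t)"]) (auto simp: S_def)
  qed
  ultimately show ?thesis
    by (rule finite_subset[rotated])
qed

section \<open>Comparison of the two minima\<close>

lemma graph_support_graph_image: "graph_support (graph_image h \<Gamma>) = h ` graph_support \<Gamma>"
  by (auto simp: graph_support_def graph_image_def)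

lemma crossings_dirs_ge_2:
  assumes \<Gamma>': "\<Gamma>' \<in> generic_reps torus tphi (graph_class torus_top (line_graph dirs))"
  shows "crossings tphi \<Gamma>' \<ge> 2"
proof -
  obtain h where h: "h \<in> Homeo0 torus_top" "\<Gamma>' = graph_image h (line_graph dirs)"
    and gen: "generic torus tphi \<Gamma>'"
    using \<Gamma>' unfolding generic_reps_def graph_class_def by blast
  obtain H where H: "continuous_on UNIV H" "\<And>z. pr (H z) = h (pr z)"
    "\<And>z l. l \<in> lat \<Longrightarrow> H (z + l) = H z + l"
    using Homeo0_lift[OF h(1)] by metis
  have dirs: "dirs \<subseteq> dirs" "dirs \<noteq> {}" by (auto simp: dirs_def)
  have inj: "inj_on h (range pr)"
    using h(1) by (simp add: Homeo0_def homeomorphic_map_def)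
  have edge_sub: "edge d \<subseteq> range pr" for d
    by (auto simp: edge_def)
  have disj: "h ` edge d \<inter> h ` edge d' = {}" if "d \<in> dirs" "d' \<in> dirs" "d \<noteq> d'" for d d'
  proof -
    have "h ` edge d \<inter> h ` edge d' = h ` (edge d \<inter> edge d')"
      using inj_on_image_Int[OF inj edge_sub edge_sub] by simp
    then show ?thesis
      using disjnt_edges[OF that] by simp
  qed
  have edges: "edges \<Gamma>' = (\<lambda>d. h ` edge d) ` dirs" and verts: "verts \<Gamma>' = {h (pr zbase)}"
    by (simp_all add: h(2) graph_image_def image_image)
  have supp: "graph_support \<Gamma>' = (\<Union>d\<in>dirs. h ` insert (pr zbase) (edge d))"
    unfolding h(2) graph_support_graph_image graph_support_line_graph[OF dirs]
    using closed_edge_eq by auto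
  have supp_sub: "graph_support \<Gamma>' \<subseteq> range pr"
    unfolding supp using H(2) edge_sub by (smt (verit) UN_least image_subset_iff insert_subset rangeE rangeI subsetD)
  have double: "\<exists>x\<in>h ` edge d. \<exists>y\<in>h ` edge d'. x \<in> graph_support \<Gamma>' \<and> y \<in> graph_support \<Gamma>' \<and> x \<noteq> y \<and> tphi x = tphi y"
    if d: "d \<in> dirs" "d' \<in> dirs" "d \<noteq> d'" for d d'
  proof -
    obtain s t where "H (line d s) + H (line d' t) = 0"
      using lift_meets_reflection[OF H(1,3) d] by metis
    then have neg: "H (line d' t) = - H (line d s)"
      by (simp add: eq_neg_iff_add_eq_0 add.commute)
    define x y where "x = h (pr (line d s))" and "y = h (pr (line d' t))"
    have xy: "x \<in> h ` insert (pr zbase) (edge d)" "y \<in> h ` insert (pr zbase) (edge d')"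
      unfolding x_def y_def using pr_line_in_closed_edge d by blast+
    then have in_supp: "x \<in> graph_support \<Gamma>'" "y \<in> graph_support \<Gamma>'"
      unfolding supp using d by blast+
    have "y = tneg x"
      using neg by (simp add: x_def y_def flip: H(2))
    then have ne: "x \<noteq> y" and eq: "tphi x = tphi y"
      using tneg_not_fixed[OF gen in_supp(1) supp_sub] by auto
    \<comment> \<open>Off the vertex, each point lies on the open edge of its own direction, which
      later tells the two crossings apart.\<close>
    have "x \<noteq> h (pr zbase)" "y \<noteq> h (pr zbase)"
      using generic_coincidence_not_vertex[OF gen in_supp ne eq] verts by auto
    then show ?thesis
      using xy in_supp ne eq by blast
  qed
  have ds: "1 \<in> dirs" "\<i> \<in> dirs" "1 + \<i> \<in> dirs" "(1::complex) \<noteq> \<i>" "1 \<noteq> 1 + \<i>" "\<i> \<noteq> 1 + \<i>"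
    by (auto simp: dirs_def complex_eq_iff)
  obtain x y where xy: "x \<in> h ` edge 1" "y \<in> h ` edge \<i>" "x \<in> graph_support \<Gamma>'" "y \<in> graph_support \<Gamma>'"
    "x \<noteq> y" "tphi x = tphi y"
    using double[OF ds(1,2,4)] by blast
  obtain x' y' where xy': "x' \<in> h ` edge 1" "y' \<in> h ` edge (1 + \<i>)" "x' \<in> graph_support \<Gamma>'" "y' \<in> graph_support \<Gamma>'"
    "x' \<noteq> y'" "tphi x' = tphi y'"
    using double[OF ds(1,3,5)] by blast
  have "tphi x \<noteq> tphi x'"
  proof
    assume "tphi x = tphi x'"
    have "{z \<in> graph_support \<Gamma>'. tphi z = tphi x} = {x, y}"
      using gen xy(3-6) unfolding generic_def by blast
    moreover have "y' \<in> {z \<in> graph_support \<Gamma>'. tphi z = tphi x}"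
      using xy'(4,6) \<open>tphi x = tphi x'\<close> by simp
    ultimately have "y' = x \<or> y' = y" by blast
    then show False
      using disj[OF ds(1,3,5)] disj[OF ds(2,3,6)] xy(1,2) xy'(2) by blast
  qed
  moreover have "{tphi x, tphi x'} \<subseteq> double_points tphi \<Gamma>'"
  proof -
    have "tphi x \<in> double_points tphi \<Gamma>'" "tphi x' \<in> double_points tphi \<Gamma>'"
      unfolding double_points_def mem_Collect_eq using xy(3-6) xy'(3-6) by metis+
    then show ?thesis by blast
  qed
  moreover have "finite (double_points tphi \<Gamma>')"
  proof (rule finite_double_points[OF gen _ _ supp_sub])
    show "finite (edges \<Gamma>')"
      by (simp add: edges finite_dirs)
    show "pairwise disjnt (edges \<Gamma>')"
      unfolding edges pairwise_def disjnt_def using disj by blast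
  qed
  ultimately have "card {tphi x, tphi x'} \<le> card (double_points tphi \<Gamma>')"
    by (intro card_mono)
  then show ?thesis
    using \<open>tphi x \<noteq> tphi x'\<close> by (simp add: crossings_def)
qed

lemma line_graph_generic_rep:
  assumes "D \<subseteq> dirs" "D \<noteq> {}"
  shows "line_graph D \<in> generic_reps torus tphi (graph_class torus_top (line_graph D))"
  using generic_line_graph[OF assms] self_in_graph_class by (simp add: generic_reps_def)

lemma min_crossings_two:
  "min_crossings torus tphi (graph_class torus_top (line_graph {1, \<i>})) \<le> 1"
proof -
  have "line_graph {1, \<i>} \<in> generic_reps torus tphi (graph_class torus_top (line_graph {1, \<i>}))"
    by (rule line_graph_generic_rep) (auto simp: dirs_def)
  then have "min_crossings torus tphi (graph_class torus_top (line_graph {1, \<i>})) \<le> crossings tphi (line_graph {1, \<i>})"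
    unfolding min_crossings_def by (intro Least_le imageI)
  then show ?thesis
    using crossings_two by simp
qed

text \<open>The straight representative makes the set of crossing numbers nonempty, so
  \<open>LEAST\<close> is attained by some representative, to which the bound for all of them
  applies.\<close>

lemma min_crossings_three:
  "min_crossings torus tphi (graph_class torus_top (line_graph dirs)) \<ge> 2"
proof -
  let ?R = "generic_reps torus tphi (graph_class torus_top (line_graph dirs))"
  have "line_graph dirs \<in> ?R"
    by (rule line_graph_generic_rep) (auto simp: dirs_def)
  then have "min_crossings torus tphi (graph_class torus_top (line_graph dirs)) \<in> crossings tphi ` ?R"
    unfolding min_crossings_def by (intro LeastI[of "\<lambda>n. n \<in> crossings tphi ` ?R"]) (rule imageI)
  then show ?thesis
    using crossings_dirs_ge_2 by force
qed

theorem corollary2p9: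
  "\<exists>(Y :: (cp1 \<times> cp1) rsurface) \<Gamma> \<phi>.
     compact_riemann_surface Y \<and>
     ribbon_graph (surf_top Y) \<Gamma> \<and> spans (surf_top Y) \<Gamma> \<and>
     nonconstant_meromorphic Y \<phi> \<and>
     generic_reps Y \<phi> (graph_class (surf_top Y) \<Gamma>) \<noteq> {} \<and>
     min_crossings Y \<phi> (graph_class (surf_top Y) \<Gamma>) \<noteq> genus Y"
proof -
  \<comment> \<open>The genus cannot be both at most 1 and at least 2; which of the two graphs
    violates the equality is left open.\<close>
  have "\<exists>D. (D = {1, \<i>} \<or> D = dirs) \<and>
      min_crossings torus tphi (graph_class torus_top (line_graph D)) \<noteq> genus torus"
    using min_crossings_two min_crossings_three by (metis not_one_le_zero one_le_numeral
      le_trans numeral_le_one_iff semiring_norm(69))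
  then obtain D where D: "D = {1, \<i>} \<or> D = dirs"
    "min_crossings torus tphi (graph_class torus_top (line_graph D)) \<noteq> genus torus"
    by blast
  have "D \<subseteq> dirs" "D \<noteq> {}" "card D \<ge> 2"
    using D(1) by (auto simp: dirs_def complex_eq_iff card_insert_if)
  then have "ribbon_graph torus_top (line_graph D)"
    "generic_reps torus tphi (graph_class torus_top (line_graph D)) \<noteq> {}"
    using ribbon_graph_line_graph line_graph_generic_rep by blast+
  moreover have "spans torus_top (line_graph D)"
    by (rule spans_line_graph[OF D(1)])
  ultimately show ?thesis
    using compact_riemann_surface_torus nonconstant_meromorphic_tphi D(2)
    by (intro exI[of _ torus] exI[of _ "line_graph D"] exI[of _ tphi]) simp
qed

end
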